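(* For every $t>0$, $r\in[0,\pi/2)$ and $z\in[-\pi,\pi]$, $$p_t(r,z)=\frac{1}{\sqrt{4\pi t}}\int_{-\infty}^{+\infty}e^{-\frac{(y+iz)^2}{4t}}\,q_t(\cos r\cosh y)\,dy.$$
   Context: $\mathbf{SU}(2)$ is the group of $2\times2$ complex unitary matrices of determinant $1$. Let $X,Y,Z$ be the left-invariant vector fields on $\mathbf{SU}(2)$ corresponding to the elements $\begin{pmatrix}0&1\\-1&0\end{pmatrix}$, $\begin{pmatrix}0&i\\i&0\end{pmatrix}$, $\begin{pmatrix}i&0\\0&-i\end{pmatrix}$ of its Lie algebra; they satisfy $[Z,X]=2Y$, $[X,Y]=2Z$, $[Y,Z]=2X$. Put $\mathcal L=X^2+Y^2$ (a subelliptic operator). Cylindric coordinates $(r,\theta,z)$, $0\le r<\pi/2$, $\theta\in[0,2\pi]$, $z\in[-\pi,\pi]$, are given by $$(r,\theta,z)\mapsto \exp(r\cos\theta\,X+r\sin\theta\,Y)\exp(zZ).$$ The normalized bi-invariant Haar measure is $d\mu=\frac{1}{4\pi^2}\sin 2r\,dr\,d\theta\,dz$. The semigroup $P_t=e^{t\mathcal L}$ has a smooth kernel with respect to $\mu$; the heat kernel issued from the identity, i.e. the function $p_t$ with $(P_tf)(\text{identity})=\int p_t f\,d\mu$, depends only on $(r,z)$ and is written $p_t(r,z)$. The function $q_t$ is defined for $t>0$ by $$q_t(x)=\sum_{m=0}^{+\infty}(m+1)e^{-m(m+2)t}U_m(x),$$ where $U_m$ is the Chebyshev polynomial of the second kind,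 $U_m(\cos x)=\frac{\sin((m+1)x)}{\sin x}$; it is given by this formula for $x\in[-1,1]$ and extended analytically (in particular to $x\in[1,+\infty)$). *)

theory Defs
  imports "HOL-Analysis.Analysis" "HOL-Complex_Analysis.Cauchy_Integral_Formula"
begin

section \<open>The group \<open>SU(2)\<close>\<close>

type_synonym cmat = "complex^2^2"

definition SU2 :: "cmat set" where
  "SU2 = {A. A ** (\<chi> i j. cnj (A $ j $ i)) = mat 1 \<and> det A = 1}"

text \<open>The library's \<open>exp\<close> is not the matrix exponential: the multiplication of the class instance on
  \<open>'a^'n\<close> is componentwise, so the exponential series is written out for \<open>**\<close>.\<close>

definition mexp :: "cmat \<Rightarrow> cmat" where
  "mexp A = (\<Sum>n. (1 / fact n) *\<^sub>R (((**) A ^^ n) (mat 1)))"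

definition su2_X :: cmat where "su2_X = vector [vector [0, 1], vector [-1, 0]]"
definition su2_Y :: cmat where "su2_Y = vector [vector [0, \<i>], vector [\<i>, 0]]"
definition su2_Z :: cmat where "su2_Z = vector [vector [\<i>, 0], vector [0, -\<i>]]"

text \<open>The left-invariant vector field of a Lie algebra element \<open>A\<close>, as a derivation.\<close>

definition left_field :: "cmat \<Rightarrow> (cmat \<Rightarrow> real) \<Rightarrow> cmat \<Rightarrow> real" where
  "left_field A f g = deriv (\<lambda>s. f (g ** mexp (s *\<^sub>R A))) 0"

text \<open>Functions on \<open>SU(2)\<close> are functions on all matrices of which only the values on
  \<open>SU2\<close> matter. \<open>X, Y, Z\<close> is a global frame, so \<open>f\<close> is of class \<open>C\<^sup>\<infinity>\<close> iff all its
  iterated derivatives along the frame exist and are continuous.\<close>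

definition smooth_SU2 :: "(cmat \<Rightarrow> real) \<Rightarrow> bool" where
  "smooth_SU2 f \<longleftrightarrow> (\<forall>As. set As \<subseteq> {su2_X, su2_Y, su2_Z} \<longrightarrow>
     continuous_on SU2 (foldr left_field As f) \<and>
     (\<forall>A\<in>{su2_X, su2_Y, su2_Z}. \<forall>g\<in>SU2.
        (\<lambda>s. foldr left_field As f (g ** mexp (s *\<^sub>R A))) differentiable at 0))"

definition sublap :: "(cmat \<Rightarrow> real) \<Rightarrow> cmat \<Rightarrow> real" where
  "sublap f g = left_field su2_X (left_field su2_X f) g + left_field su2_Y (left_field su2_Y f) g"


section \<open>Cylindric coordinates and Haar measure\<close>

definition cyl :: "real \<Rightarrow> real \<Rightarrow> real \<Rightarrow> cmat" where
  "cyl r \<theta> z = mexp ((r * cos \<theta>) *\<^sub>R su2_X + (r * sin \<theta>) *\<^sub>R su2_Y) ** mexp (z *\<^sub>R su2_Z)"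

definition haar_SU2 :: "cmat measure" where
  "haar_SU2 = distr
     (density lborel (\<lambda>(r, \<theta>, z).
        ennreal (sin (2 * r) / (4 * pi\<^sup>2)) * indicator ({0..<pi/2} \<times> {0..2*pi} \<times> {-pi..pi}) (r, \<theta>, z)))
     (restrict_space borel SU2) (\<lambda>(r, \<theta>, z). cyl r \<theta> z)"


section \<open>The semigroup \<open>e\<^sup>t\<^sup>L\<close> and its kernel\<close>

text \<open>\<open>e\<^sup>t\<^sup>L\<close> is the strongly continuous contraction semigroup on the space of
  continuous functions on \<open>SU(2)\<close>, with the supremum norm, whose generator is the closure of
  \<open>sublap\<close> on smooth functions.\<close>

definition C0_contraction_semigroup :: "(real \<Rightarrow> (cmat \<Rightarrow> real) \<Rightarrow> cmat \<Rightarrow> real) \<Rightarrow> bool" where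
  "C0_contraction_semigroup P \<longleftrightarrow>
     (\<forall>t\<ge>0. \<forall>f. continuous_on SU2 f \<longrightarrow> continuous_on SU2 (P t f)) \<and>
     (\<forall>t\<ge>0. \<forall>f h a b. continuous_on SU2 f \<longrightarrow> continuous_on SU2 h \<longrightarrow>
        (\<forall>g\<in>SU2. P t (\<lambda>x. a * f x + b * h x) g = a * P t f g + b * P t h g)) \<and>
     (\<forall>t\<ge>0. \<forall>f M. continuous_on SU2 f \<longrightarrow> (\<forall>g\<in>SU2. \<bar>f g\<bar> \<le> M) \<longrightarrow> (\<forall>g\<in>SU2. \<bar>P t f g\<bar> \<le> M)) \<and>
     (\<forall>f. continuous_on SU2 f \<longrightarrow> (\<forall>g\<in>SU2. P 0 f g = f g)) \<and>
     (\<forall>s\<ge>0. \<forall>t\<ge>0. \<forall>f. continuous_on SU2 f \<longrightarrow> (\<forall>g\<in>SU2. P (s + t) f g = P s (P t f) g)) \<and>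
     (\<forall>f. continuous_on SU2 f \<longrightarrow> uniform_limit SU2 (\<lambda>t. P t f) f (at_right 0))"

definition is_generator_value ::
    "(real \<Rightarrow> (cmat \<Rightarrow> real) \<Rightarrow> cmat \<Rightarrow> real) \<Rightarrow> (cmat \<Rightarrow> real) \<Rightarrow> (cmat \<Rightarrow> real) \<Rightarrow> bool" where
  "is_generator_value P f h \<longleftrightarrow> continuous_on SU2 f \<and> continuous_on SU2 h \<and>
     uniform_limit SU2 (\<lambda>t g. (P t f g - f g) / t) h (at_right 0)"

definition subelliptic_heat_semigroup :: "(real \<Rightarrow> (cmat \<Rightarrow> real) \<Rightarrow> cmat \<Rightarrow> real) \<Rightarrow> bool" where
  "subelliptic_heat_semigroup P \<longleftrightarrow> C0_contraction_semigroup P \<and>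
     (\<forall>f h. is_generator_value P f h \<longleftrightarrow>
        (\<exists>u. (\<forall>n::nat. smooth_SU2 (u n)) \<and>
             uniform_limit SU2 u f sequentially \<and>
             uniform_limit SU2 (\<lambda>n. sublap (u n)) h sequentially))"

definition heat_kernel_at_identity ::
    "(real \<Rightarrow> (cmat \<Rightarrow> real) \<Rightarrow> cmat \<Rightarrow> real) \<Rightarrow> (real \<Rightarrow> cmat \<Rightarrow> real) \<Rightarrow> bool" where
  "heat_kernel_at_identity P p \<longleftrightarrow> (\<forall>t>0. smooth_SU2 (p t) \<and>
     (\<forall>f. continuous_on SU2 f \<longrightarrow> P t f (mat 1) = (LINT g|haar_SU2. p t g * f g)))"


section \<open>The function \<open>q\<^sub>t\<close>\<close>

fun cheb_U :: "nat \<Rightarrow> 'a::comm_ring_1 \<Rightarrow> 'a" where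
  "cheb_U 0 x = 1"
| "cheb_U (Suc 0) x = 2 * x"
| "cheb_U (Suc (Suc n)) x = 2 * x * cheb_U (Suc n) x - cheb_U n x"

text \<open>The series converges at every complex argument and its sum is entire (proved below), so it
  is the analytic extension of its restriction to \<open>[-1, 1]\<close>.\<close>

definition heat_q :: "real \<Rightarrow> 'a::{real_normed_field, banach} \<Rightarrow> 'a" where
  "heat_q t x = (\<Sum>m. of_real ((real m + 1) * exp (- real m * (real m + 2) * t)) * cheb_U m x)"

lemma cheb_U_cos: "sin x * cheb_U m (cos x) = sin ((real m + 1) * x)"
proof (induction m rule: cheb_U.induct[where ?P="\<lambda>m (_::real). sin x * cheb_U m (cos x) = sin ((real m + 1) * x)"])
  case (2 y) then show ?case by (simp add: sin_double)
next
  case (3 n y)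
  have "sin ((real (Suc (Suc n)) + 1) * x) + sin ((real n + 1) * x) = 2 * cos x * sin ((real (Suc n) + 1) * x)"
    using sin_plus_sin[of "(real (Suc (Suc n)) + 1) * x" "(real n + 1) * x"]
    by (simp add: algebra_simps add_divide_distrib)
  with 3 show ?case by (simp add: algebra_simps)
qed auto

lemma cheb_U_of_real:
  "cheb_U m (of_real x :: 'a::{real_normed_field, banach}) = of_real (cheb_U m x)"
  by (induction m x rule: cheb_U.induct) simp_all

lemma norm_cheb_U_le:
  fixes x :: "'a::{real_normed_field, banach}"
  shows "norm (cheb_U m x) \<le> (2 * norm x + 1) ^ m"
proof (induction m x rule: cheb_U.induct)
  case (3 n x)
  let ?K = "2 * norm x + 1"
  have "norm (cheb_U (Suc (Suc n)) x) \<le> 2 * norm x * norm (cheb_U (Suc n) x) + norm (cheb_U n x)"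
    using norm_triangle_ineq4[of "2 * x * cheb_U (Suc n) x" "cheb_U n x"] by (simp add: norm_mult)
  also have "\<dots> \<le> 2 * norm x * ?K ^ Suc n + ?K ^ n"
    using 3 by (intro add_mono mult_left_mono) auto
  also have "\<dots> \<le> 2 * norm x * ?K ^ Suc n + ?K ^ Suc n"
    by (intro add_left_mono power_increasing) auto
  also have "\<dots> = ?K ^ Suc (Suc n)" by (simp add: algebra_simps)
  finally show ?case .
qed (auto simp: norm_mult)

lemma summable_heat_q_bound:
  fixes K t :: real
  assumes "t > 0" "K \<ge> 0"
  shows "summable (\<lambda>m. (real m + 1) * exp (- real m * (real m + 2) * t) * K ^ m)"
proof -
  have "((\<lambda>m. 2 * K * exp (- (real m + 2) * t)) \<longlongrightarrow> 0) sequentially"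
  proof -
    have "((\<lambda>m. 2 * K * exp (- 2 * t) * exp (- t) ^ m) \<longlongrightarrow> 2 * K * exp (- 2 * t) * 0) sequentially"
      using assms by (intro tendsto_intros LIMSEQ_realpow_zero) auto
    moreover have "2 * K * exp (- 2 * t) * exp (- t) ^ m = 2 * K * exp (- (real m + 2) * t)" for m
    proof -
      have "exp (- 2 * t) * exp (- t) ^ m = exp (- 2 * t + real m * (- t))"
        by (simp only: exp_add exp_of_nat_mult)
      also have "- 2 * t + real m * (- t) = - (real m + 2) * t" by (simp add: algebra_simps)
      finally show ?thesis by simp
    qed
    ultimately show ?thesis by (simp only: mult_zero_right)
  qed
  then have ev: "eventually (\<lambda>m. 2 * K * exp (- (real m + 2) * t) < 1/2) sequentially"
    by (rule order_tendstoD) auto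
  show ?thesis
  proof (rule summable_comparison_test_ev)
    show "summable (\<lambda>m. (1/2::real) ^ m)" by (rule summable_geometric) auto
    show "\<forall>\<^sub>F m in sequentially.
        norm ((real m + 1) * exp (- real m * (real m + 2) * t) * K ^ m) \<le> (1/2) ^ m"
      using ev
    proof eventually_elim
      case (elim m)
      have "real m + 1 \<le> 2 ^ m"
        by (induction m) auto
      then have "(real m + 1) * exp (- real m * (real m + 2) * t) * K ^ m
          \<le> 2 ^ m * exp (- (real m + 2) * t) ^ m * K ^ m"
        using assms by (intro mult_right_mono mult_mono) (auto simp: exp_of_nat_mult[symmetric] algebra_simps)
      also have "\<dots> = (2 * K * exp (- (real m + 2) * t)) ^ m"
        by (simp add: power_mult_distrib)
      also have "\<dots> \<le> (1/2) ^ m"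
        using elim assms by (intro power_mono) auto
      finally show ?case using assms by simp
    qed
  qed
qed

lemma heat_q_summable:
  fixes x :: "'a::{real_normed_field, banach}"
  assumes "t > 0"
  shows "summable (\<lambda>m. of_real ((real m + 1) * exp (- real m * (real m + 2) * t)) * cheb_U m x)"
proof (rule summable_comparison_test')
  show "summable (\<lambda>m. (real m + 1) * exp (- real m * (real m + 2) * t) * (2 * norm x + 1) ^ m)"
    by (rule summable_heat_q_bound) (use assms in auto)
  fix m :: nat
  let ?a = "(real m + 1) * exp (- real m * (real m + 2) * t)"
  have "norm (of_real ?a * cheb_U m x) = ?a * norm (cheb_U m x)"
    by (simp only: norm_mult norm_of_real) (simp add: abs_mult)
  also have "\<dots> \<le> ?a * (2 * norm x + 1) ^ m"
    by (intro mult_left_mono norm_cheb_U_le) auto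
  finally show "norm (of_real ?a * cheb_U m x) \<le> ?a * (2 * norm x + 1) ^ m" .
qed

lemma heat_q_of_real:
  assumes "t > 0"
  shows "heat_q t (of_real x :: 'a::{real_normed_field, banach}) = of_real (heat_q t x)"
  using suminf_of_real[OF heat_q_summable[OF assms, of x], where 'a='a]
  by (simp add: heat_q_def cheb_U_of_real)

lemma cheb_U_holomorphic: "(\<lambda>x. cheb_U m x) holomorphic_on A"
proof -
  have "(\<lambda>x. cheb_U m x) holomorphic_on A \<and> (\<lambda>x. cheb_U (Suc m) x) holomorphic_on A"
    by (induction m) (auto intro!: holomorphic_intros)
  then show ?thesis by simp
qed

lemma heat_q_holomorphic:
  assumes t: "t > 0"
  shows "(heat_q t :: complex \<Rightarrow> complex) holomorphic_on UNIV"
proof (rule holomorphic_uniform_sequence)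
  let ?a = "\<lambda>m. (real m + 1) * exp (- real m * (real m + 2) * t)"
  show "(\<lambda>x. \<Sum>m<n. of_real (?a m) * cheb_U m x) holomorphic_on (UNIV::complex set)" for n
    by (intro holomorphic_intros cheb_U_holomorphic)
  fix x :: complex
  have "uniform_limit (cball x 1) (\<lambda>n x. \<Sum>m<n. of_real (?a m) * cheb_U m x)
     (\<lambda>x. \<Sum>m. of_real (?a m) * cheb_U m x) sequentially"
  proof (rule Weierstrass_m_test)
    fix m y assume "y \<in> cball x 1"
    then have "norm y \<le> norm x + 1"
      using norm_triangle_sub[of y x] by (simp add: dist_norm norm_minus_commute)
    then have "norm (cheb_U m y) \<le> (2 * (norm x + 1) + 1) ^ m"
      by (intro order_trans[OF norm_cheb_U_le] power_mono) auto
    then have "?a m * norm (cheb_U m y) \<le> ?a m * (2 * (norm x + 1) + 1) ^ m"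
      by (intro mult_left_mono) auto
    moreover have "norm (of_real (?a m) * cheb_U m y) = ?a m * norm (cheb_U m y)"
      by (simp only: norm_mult norm_of_real) (simp add: abs_mult)
    ultimately show "norm (of_real (?a m) * cheb_U m y) \<le> ?a m * (2 * (norm x + 1) + 1) ^ m" by simp
  qed (intro summable_heat_q_bound t, simp)
  then show "\<exists>d>0. cball x d \<subseteq> UNIV \<and> uniform_limit (cball x d)
      (\<lambda>n x. \<Sum>m<n. of_real (?a m) * cheb_U m x) (heat_q t) sequentially"
    unfolding heat_q_def[abs_def] by (intro exI[of _ 1]) auto
qed simp


section \<open>The coordinate formula and the total mass of the measure\<close>

lemma mexp_rotation:
  assumes V: "V ** V = - mat 1"
  shows "mexp (s *\<^sub>R V) = cos s *\<^sub>R mat 1 + sin s *\<^sub>R V"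
proof -
  have scale: "(a *\<^sub>R A) ** (b *\<^sub>R B) = (a * b) *\<^sub>R (A ** B)" for a b and A B :: cmat
    by (simp add: vec_eq_iff matrix_matrix_mult_def sum_2 scaleR_conv_of_real[where 'a=complex] algebra_simps)
  have VV: "A ** (- B) = - (A ** B)" for A B :: cmat
    by (simp add: vec_eq_iff matrix_matrix_mult_def sum_2)
  have pow: "((**) (s *\<^sub>R V) ^^ (2*n)) (mat 1) = (s^(2*n) * (-1)^n) *\<^sub>R mat 1 \<and>
       ((**) (s *\<^sub>R V) ^^ (Suc (2*n))) (mat 1) = (s^(Suc (2*n)) * (-1)^n) *\<^sub>R V" for n
  proof (induction n)
    case 0 then show ?case by simp
  next
    case (Suc n)
    have 1: "((**) (s *\<^sub>R V) ^^ (2 * Suc n)) (mat 1) = (s^(2*Suc n) * (-1)^Suc n) *\<^sub>R mat 1"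
      using Suc by (simp add: scale V algebra_simps)
    have "((**) (s *\<^sub>R V) ^^ Suc (2 * Suc n)) (mat 1) = (s *\<^sub>R V) ** ((s^(2*Suc n) * (-1)^Suc n) *\<^sub>R mat 1)"
      using 1 by simp
    also have "\<dots> = (s^(Suc (2*Suc n)) * (-1)^Suc n) *\<^sub>R V"
      by (simp only: scale matrix_mul_rid) (simp add: algebra_simps)
    finally show ?case using 1 by blast
  qed
  have term_eq: "(1 / fact n) *\<^sub>R (((**) (s *\<^sub>R V) ^^ n) (mat 1))
      = (cos_coeff n *\<^sub>R s^n) *\<^sub>R mat 1 + (sin_coeff n *\<^sub>R s^n) *\<^sub>R V" for n
  proof (cases "even n")
    case True
    then obtain k where "n = 2 * k" by blast
    with pow[of k] show ?thesis by (simp add: cos_coeff_def sin_coeff_def field_simps)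
  next
    case False
    then obtain k where "n = Suc (2 * k)" by (metis oddE Suc_eq_plus1)
    with pow[of k] show ?thesis by (simp add: cos_coeff_def sin_coeff_def field_simps del: funpow.simps)
  qed
  have "(\<lambda>n. (cos_coeff n *\<^sub>R s^n) *\<^sub>R (mat 1 :: cmat) + (sin_coeff n *\<^sub>R s^n) *\<^sub>R V)
      sums (cos s *\<^sub>R mat 1 + sin s *\<^sub>R V)"
    by (intro sums_add sums_scaleR_left cos_converges sin_converges)
  then show ?thesis
    unfolding mexp_def term_eq by (rule sums_unique[symmetric])
qed

lemma cyl_eq:
  "cyl r \<theta> z =
     vector [vector [complex_of_real (cos r) * cis z, complex_of_real (sin r) * cis (\<theta> - z)],
             vector [- complex_of_real (sin r) * cis (z - \<theta>), complex_of_real (cos r) * cis (- z)]]"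
proof -
  let ?V = "cos \<theta> *\<^sub>R su2_X + sin \<theta> *\<^sub>R su2_Y"
  have pyth: "complex_of_real (cos \<theta>) * of_real (cos \<theta>) + of_real (sin \<theta>) * of_real (sin \<theta>) = 1"
    by (metis of_real_1 of_real_add of_real_mult sin_cos_squared_add3)
  have V: "?V ** ?V = - mat 1"
    using pyth
    by (simp add: vec_eq_iff forall_2 matrix_matrix_mult_def sum_2 su2_X_def su2_Y_def mat_def
        scaleR_conv_of_real[where 'a=complex] algebra_simps complex_eq_iff)
  have Z: "su2_Z ** su2_Z = - mat 1"
    by (simp add: vec_eq_iff forall_2 matrix_matrix_mult_def sum_2 su2_Z_def mat_def)
  have 1: "(r * cos \<theta>) *\<^sub>R su2_X + (r * sin \<theta>) *\<^sub>R su2_Y = r *\<^sub>R ?V"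
    by (simp add: scaleR_add_right)
  show ?thesis
    unfolding cyl_def 1 mexp_rotation[OF V] mexp_rotation[OF Z]
    by (simp add: vec_eq_iff forall_2 matrix_matrix_mult_def sum_2 su2_X_def su2_Y_def su2_Z_def mat_def
        scaleR_conv_of_real[where 'a=complex] algebra_simps complex_eq_iff cos_diff sin_diff)
qed

lemma cyl_in_SU2: "cyl r \<theta> z \<in> SU2"
proof -
  have pyth: "complex_of_real (cos r) * of_real (cos r) + of_real (sin r) * of_real (sin r) = 1"
    by (metis of_real_1 of_real_add of_real_mult sin_cos_squared_add3)
  have c: "cis z * cis (- z) = 1" "cis (\<theta> - z) * cis (z - \<theta>) = 1"
    by (simp_all add: cis_mult)
  have c': "cnj (cis (\<theta> - z)) = cis (z - \<theta>)" "cnj (cis (z - \<theta>)) = cis (\<theta> - z)"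
    by (simp_all add: cis_cnj)
  have n: "C * a * (C * b) + S * d * (S * e) = 1"
    if "a * b = 1" "d * e = 1" "C * C + S * S = 1" for a b C S d e :: complex
    using that by algebra
  show ?thesis
    using n[OF c pyth] n[OF c(1) _ pyth, of "cis (z - \<theta>)" "cis (\<theta> - z)"] c
    by (simp add: SU2_def cyl_eq vec_eq_iff forall_2 matrix_matrix_mult_def sum_2 mat_def det_2
        cis_cnj c' algebra_simps)
qed

lemma cyl_measurable:
  "(\<lambda>(r, \<theta>, z). cyl r \<theta> z) \<in> borel \<rightarrow>\<^sub>M restrict_space borel SU2"
proof -
  have "continuous_on UNIV (\<lambda>x::real\<times>real\<times>real. cyl (fst x) (fst (snd x)) (snd (snd x)))"
  proof -
    have "continuous_on UNIV (\<lambda>x::real\<times>real\<times>real. cyl (fst x) (fst (snd x)) (snd (snd x)) $ i $ j)" for i j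
      using exhaust_2[of i] exhaust_2[of j]
      by (elim disjE; simp add: cyl_eq cis_conv_exp; intro continuous_intros)
    then have "continuous_on UNIV (\<lambda>x::real\<times>real\<times>real.
        \<chi> i. \<chi> j. cyl (fst x) (fst (snd x)) (snd (snd x)) $ i $ j)"
      by (intro continuous_on_vec_lambda) auto
    then show ?thesis by simp
  qed
  then show ?thesis
    by (intro measurable_restrict_space2)
       (auto simp: cyl_in_SU2 case_prod_beta' intro!: borel_measurable_continuous_onI)
qed

lemma emeasure_haar_SU2: "emeasure haar_SU2 (space haar_SU2) = 1"
proof -
  let ?f = "\<lambda>r. ennreal (sin (2 * r) / (4 * pi\<^sup>2)) * indicator {0..pi/2} r"
  let ?h = "\<lambda>(r, \<theta>, z). ?f r * (indicator {0..2*pi} \<theta> * indicator {-pi..pi} z)"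
  have h: "(\<lambda>(r, \<theta>, z). ennreal (sin (2 * r) / (4 * pi\<^sup>2)) *
      indicator ({0..<pi/2} \<times> {0..2*pi} \<times> {-pi..pi}) (r, \<theta>, z)) = ?h"
  proof (intro ext, clarify)
    fix r \<theta> z :: real
    show "ennreal (sin (2 * r) / (4 * pi\<^sup>2)) *
      indicator ({0..<pi/2} \<times> {0..2*pi} \<times> {-pi..pi}) (r, \<theta>, z) =
      ?f r * (indicator {0..2*pi} \<theta> * indicator {-pi..pi} z)"
    proof (cases "r = pi/2")
      case True
      then have "2 * r = pi" by simp
      then have "sin (2 * r) = 0" by (simp only: sin_pi)
      then show ?thesis by (simp only: div_0 ennreal_0 mult_zero_left)
    qed (auto simp: indicator_def)
  qed
  have m: "?h \<in> borel_measurable borel"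
    by (simp add: borel_prod[symmetric])
  have int: "(\<integral>\<^sup>+r. ?f r \<partial>lborel) = ennreal (1 / (4 * pi\<^sup>2))"
  proof -
    have "(\<integral>\<^sup>+r. ?f r \<partial>lborel) = - cos (2 * (pi/2)) / (8 * pi\<^sup>2) - - cos (2 * 0) / (8 * pi\<^sup>2)"
      by (rule nn_integral_FTC_Icc)
         (auto intro!: derivative_eq_intros sin_ge_zero divide_nonneg_nonneg simp: field_simps)
    then show ?thesis by (simp add: field_simps)
  qed
  have "emeasure haar_SU2 (space haar_SU2) = (\<integral>\<^sup>+x. ?h x \<partial>lborel)"
  proof -
    have "(\<lambda>(r, \<theta>, z). cyl r \<theta> z) \<in> density lborel ?h \<rightarrow>\<^sub>M restrict_space borel SU2"
      using cyl_measurable by (simp cong: measurable_cong_sets)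
    moreover have "(\<lambda>(r, \<theta>, z). cyl r \<theta> z) -` SU2 \<inter> UNIV = UNIV"
      by (auto simp: cyl_in_SU2)
    ultimately show ?thesis
      unfolding haar_SU2_def h using m
      by (subst emeasure_distr) (auto simp: space_restrict_space sets_restrict_space emeasure_density cyl_in_SU2)
  qed
  also have "\<dots> = (\<integral>\<^sup>+r. (\<integral>\<^sup>+y. ?h (r, y) \<partial>lborel) \<partial>lborel)"
    using m by (subst lborel_prod[symmetric], subst lborel.nn_integral_fst[symmetric])
      (simp_all add: lborel_prod)
  also have "\<dots> = (\<integral>\<^sup>+r. ?f r * (\<integral>\<^sup>+y. indicator ({0..2*pi} \<times> {-pi..pi}) y \<partial>lborel) \<partial>lborel)"
    by (intro nn_integral_cong, subst nn_integral_cmult[symmetric])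
       (auto intro!: nn_integral_cong simp: indicator_def case_prod_beta borel_prod[symmetric])
  also have "(\<integral>\<^sup>+y. indicator ({0..2*pi} \<times> {-pi..pi}) y \<partial>lborel) = ennreal (4 * pi\<^sup>2)"
  proof -
    have "emeasure lborel ({0..2*pi} \<times> {-pi..pi}) = ennreal (2 * pi) * ennreal (2 * pi)"
      by (simp add: lborel_prod[symmetric] lborel.emeasure_pair_measure_Times)
    then show ?thesis
      by (subst nn_integral_indicator)
        (auto simp: borel_prod[symmetric] ennreal_mult[symmetric] power2_eq_square)
  qed
  also have "(\<integral>\<^sup>+r. ?f r * ennreal (4 * pi\<^sup>2) \<partial>lborel) = ennreal (1 / (4 * pi\<^sup>2)) * ennreal (4 * pi\<^sup>2)"
    by (subst nn_integral_multc) (simp_all add: int)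
  also have "\<dots> = 1"
    by (simp add: ennreal_mult[symmetric])
  finally show ?thesis .
qed

end

theory Submission
  imports Defs "HOL-Probability.Characteristic_Functions" "HOL-Real_Asymp.Real_Asymp"
begin

text \<open>
  Write \<open>\<alpha>\<close>, \<open>\<beta>\<close> for the first row of a matrix in \<open>SU(2)\<close>; in cylindric coordinates
  \<open>\<alpha> = cos r e\<^sup>i\<^sup>z\<close> and \<open>\<beta> = sin r e\<^sup>i\<^sup>(\<^sup>\<theta>\<^sup>-\<^sup>z\<^sup>)\<close>. Formally the formula says
  \<open>e\<^sup>t\<^sup>L = e\<^sup>-\<^sup>t\<^sup>Z\<^sup>Z e\<^sup>t\<^sup>\<Delta>\<close> for \<open>\<Delta> = L + Z\<^sup>2\<close>: the function \<open>q\<^sub>t(cos r cos z)\<close> is the heat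
  kernel of \<open>\<Delta>\<close>, and the Gaussian integral, which multiplies the component of
  frequency \<open>n\<close> in the variable \<open>z\<close> by \<open>exp (n\<^sup>2 t)\<close>, is the backward heat flow
  along \<open>Z\<close>. The proof makes this rigorous by comparing the integrals of both sides against all
  polynomials.

  The disk (Zernike) polynomials \<open>disk k l\<close> split the character of degree \<open>m\<close> into frequencies,
  \<open>U\<^sub>m((a + b)/2) = \<Sum>\<^sub>k disk k (m - k) a b\<close>. Inserting this into \<open>q\<^sub>t\<close> and integrating against the
  Gaussian term by term turns the right-hand side into the series
  \<open>heat_series t \<alpha> = \<Sum> (k + l + 1) exp (- (4kl + 2k + 2l) t) disk k l \<alpha>* \<alpha>\<close> over all \<open>k\<close> and \<open>l\<close>,
  where \<open>\<alpha>*\<close> is the conjugate (\<open>gauss_transform_heat_q\<close>). It converges uniformly on \<open>SU(2)\<close> because a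
  disk polynomial of degree \<open>m\<close>, being a Fourier coefficient of \<open>U\<^sub>m(\<rho> cos z)\<close>, is bounded by
  \<open>m + 1\<close> on the unit disk.

  On \<open>SU(2)\<close> every polynomial function is a real combination of real parts of monomials
  \<open>c \<alpha>\<^sup>p \<alpha>*\<^sup>q \<beta>\<^sup>k\<close>, and \<open>L\<close> is triangular on these: it maps the monomial with exponents \<open>(p, q, k)\<close> to
  a multiple of itself plus a multiple of the one with exponents \<open>(p - 1, q - 1, k)\<close>. Since \<open>P\<^sub>t\<close> is
  generated by \<open>L\<close>, its values at the identity on the monomials solve a triangular system of linear
  differential equations, which determines them: they vanish for \<open>k > 0\<close> and are the explicit
  sums \<open>monomial_heat p q t\<close> for \<open>k = 0\<close> (\<open>semigroup_re_monomial\<close>). On the other side, the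
  integrals of \<open>heat_series t\<close> against the same monomials reduce to one-dimensional moments
  of disk polynomials, and they give the same sums (\<open>haar_heat_series_monomial\<close>).

  So \<open>p\<^sub>t - heat_series t\<close> is a continuous function orthogonal to all polynomials, hence zero by the
  Stone-Weierstrass theorem.
\<close>

section \<open>Disk polynomials\<close>

text \<open>The polynomials with generating function \<open>\<Sum> disk k l a b s\<^sup>k u\<^sup>l = 1 / (1 - a s - b u + s u)\<close>. For \<open>b\<close>
  the conjugate of \<open>a\<close> these are the classical disk polynomials, normalized to \<open>1\<close> at \<open>a = 1\<close>. The
  recursion is the definition because it carries the inductions below, in particular the one that
  computes the moments.\<close>
fun disk :: "nat \<Rightarrow> nat \<Rightarrow> 'a::comm_ring_1 \<Rightarrow> 'a \<Rightarrow> 'a" where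
  "disk 0 l a b = b ^ l"
| "disk (Suc k) 0 a b = a ^ Suc k"
| "disk (Suc k) (Suc l) a b = a * disk k (Suc l) a b + b * disk (Suc k) l a b - disk k l a b"

lemma disk_0_right: "disk k 0 a b = a ^ k"
  by (cases k) auto

text \<open>Setting \<open>s = u\<close> in the generating function gives \<open>1 / (1 - (a + b) s + s\<^sup>2)\<close>, the generating function
  of the Chebyshev polynomials.\<close>
lemma cheb_U_eq_sum_disk:
  assumes "2 * x = a + b"
  shows "cheb_U m x = (\<Sum>k\<le>m. disk k (m - k) a b)"
  using assms
proof (induction m x rule: cheb_U.induct)
  case (3 m x)
  have "(\<Sum>k\<le>Suc (Suc m). disk k (Suc (Suc m) - k) a b)
      = disk 0 (Suc (Suc m)) a b + (\<Sum>k\<le>m. disk (Suc k) (Suc (m - k)) a b) + disk (Suc (Suc m)) 0 a b"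
    by (subst sum.atMost_Suc, subst sum.atMost_Suc_shift) (simp add: Suc_diff_le)
  also have "\<dots> = b ^ Suc (Suc m) + (a * (\<Sum>k\<le>m. disk k (Suc m - k) a b)
       + b * (\<Sum>k\<le>m. disk (Suc k) (m - k) a b) - (\<Sum>k\<le>m. disk k (m - k) a b)) + a ^ Suc (Suc m)"
    by (simp add: sum.distrib sum_subtractf sum_distrib_left Suc_diff_le)
  also have "a * (\<Sum>k\<le>m. disk k (Suc m - k) a b) = a * (\<Sum>k\<le>Suc m. disk k (Suc m - k) a b) - a ^ Suc (Suc m)"
    by (simp add: algebra_simps disk_0_right)
  also have "b * (\<Sum>k\<le>m. disk (Suc k) (m - k) a b) = b * (\<Sum>k\<le>Suc m. disk k (Suc m - k) a b) - b ^ Suc (Suc m)"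
    by (subst sum.atMost_Suc_shift) (simp add: algebra_simps)
  finally have "(\<Sum>k\<le>Suc (Suc m). disk k (Suc (Suc m) - k) a b)
     = (a + b) * (\<Sum>k\<le>Suc m. disk k (Suc m - k) a b) - (\<Sum>k\<le>m. disk k (m - k) a b)"
    by (simp add: algebra_simps)
  then show ?case using 3 by simp
qed (auto simp: algebra_simps)

text \<open>Each monomial \<open>a\<^sup>i b\<^sup>j\<close> of \<open>disk k l\<close> satisfies \<open>i - j = k - l\<close>. Hence \<open>disk k l\<close> carries the single
  frequency \<open>k - l\<close> when \<open>a\<close> and \<open>b\<close> are rotated in opposite directions.\<close>
lemma disk_scale:
  assumes "c * c' = 1"
  shows "disk k l (c * a) (c' * b) = c ^ k * c' ^ l * disk k l a b"
proof (induction k l a b rule: disk.induct)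
  case (3 k l a b)
  have "c ^ k * c' ^ l = c ^ Suc k * c' ^ Suc l"
    using assms by (metis (no_types, lifting) mult.left_commute mult.right_neutral power_Suc mult.assoc)
  have "disk (Suc k) (Suc l) (c * a) (c' * b) = c ^ Suc k * c' ^ Suc l * (a * disk k (Suc l) a b)
      + c ^ Suc k * c' ^ Suc l * (b * disk (Suc k) l a b) - c ^ k * c' ^ l * disk k l a b"
    using 3 by (simp add: algebra_simps)
  also have "c ^ k * c' ^ l = c ^ Suc k * c' ^ Suc l" by fact
  finally show ?case by (simp only: disk.simps ring_distribs)
qed (simp_all add: power_mult_distrib algebra_simps)

lemma disk_1_1: "disk k l 1 1 = 1"
  by (induction k l "1::'a" "1::'a" rule: disk.induct) auto

lemma disk_of_real:
  "disk k l (of_real a) (of_real b) = (of_real (disk k l a b) :: 'a::{real_normed_field})"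
  by (induction k l a b rule: disk.induct) auto

lemma continuous_on_disk [continuous_intros]:
  fixes a b :: "'a::topological_space \<Rightarrow> 'b::real_normed_field"
  assumes "continuous_on S a" "continuous_on S b"
  shows "continuous_on S (\<lambda>x. disk k l (a x) (b x))"
  by (induction k l "0::'b" "0::'b" rule: disk.induct) (auto intro!: continuous_intros assms)

text \<open>At \<open>x = cos y\<close> the decomposition into disk polynomials is a sum of \<open>m + 1\<close> unimodular numbers.\<close>
lemma abs_cheb_U_le:
  fixes x :: real
  assumes "\<bar>x\<bar> \<le> 1"
  shows "\<bar>cheb_U m x\<bar> \<le> real m + 1"
proof -
  define y where "y = arccos x"
  have x: "x = cos y" unfolding y_def using assms by (simp add: abs_le_iff)
  have d: "disk k l (cis y) (cis (- y)) = cis y ^ k * cis (- y) ^ l" for k l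
    using disk_scale[of "cis y" "cis (- y)" k l 1 1] by (simp add: disk_1_1 cis_mult)
  have "complex_of_real (cheb_U m x) = cheb_U m (of_real x)"
    by (simp add: cheb_U_of_real)
  also have "\<dots> = (\<Sum>k\<le>m. disk k (m - k) (cis y) (cis (- y)))"
    by (rule cheb_U_eq_sum_disk) (simp add: x complex_eq_iff)
  also have "norm \<dots> \<le> (\<Sum>k\<le>m. 1)"
    unfolding d by (rule sum_norm_le) (simp add: norm_mult norm_power)
  finally show ?thesis by simp
qed

lemma integral_cis_period:
  "((\<lambda>z. cis (of_int n * z)) has_integral (if n = 0 then 2 * pi else 0)) {a..a + 2 * pi}"
proof (cases "n = 0")
  case True
  have "((\<lambda>z. 1::complex) has_integral (measure lborel {a..a + 2 * pi} *\<^sub>R 1)) {a..a + 2 * pi}"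
    by (rule has_integral_const_real)
  then show ?thesis using True by (simp add: scaleR_conv_of_real)
next
  case False
  have "((\<lambda>z. cis (of_int n * z)) has_integral
     (cis (of_int n * (a + 2 * pi)) / (\<i> * of_int n) - cis (of_int n * a) / (\<i> * of_int n))) {a..a + 2 * pi}"
  proof (rule fundamental_theorem_of_calculus)
    show "((\<lambda>z. cis (of_int n * z) / (\<i> * of_int n)) has_vector_derivative cis (of_int n * x)) (at x within {a..a + 2 * pi})" for x
      using False
      by (auto simp: cis_conv_exp field_simps intro!: has_vector_derivative_real_field derivative_eq_intros)
  qed auto
  moreover have "cis (of_int n * (a + 2 * pi)) = cis (of_int n * a)"
    using cis_multiple_2pi[of "of_int n"] by (simp add: ring_distribs cis_mult[symmetric] mult_ac)
  ultimately show ?thesis using False by simp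
qed

text \<open>By \<open>cheb_U_eq_sum_disk\<close> and \<open>disk_scale\<close>, the number \<open>disk k l \<rho> \<rho>\<close> is the Fourier coefficient of
  frequency \<open>k - l\<close> of the function \<open>U\<^sub>m(\<rho> cos z)\<close> with \<open>m = k + l\<close>, which is bounded by \<open>m + 1\<close>.\<close>
lemma abs_disk_diag_le:
  fixes \<rho> :: real
  assumes "0 \<le> \<rho>" "\<rho> \<le> 1"
  shows "\<bar>disk k l \<rho> \<rho>\<bar> \<le> real (k + l) + 1"
proof -
  define m where "m = k + l"
  let ?d = "\<lambda>j. complex_of_real (disk j (m - j) \<rho> \<rho>)"
  \<comment> \<open>The factor \<open>cis ((l - k) z)\<close> shifts the frequency \<open>k - l\<close> to \<open>0\<close>.\<close>
  let ?U = "\<lambda>z. complex_of_real (cheb_U m (\<rho> * cos z)) * cis (of_int (int l - int k) * z)"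
  have cc: "cis z * cis (- z) = 1" for z
    by (simp add: cis_mult)
  have U: "?U z = (\<Sum>j\<le>m. cis (of_int (2 * (int j - int k)) * z) * ?d j)" for z
  proof -
    have "complex_of_real (cheb_U m (\<rho> * cos z)) = cheb_U m (of_real (\<rho> * cos z))"
      by (rule cheb_U_of_real[symmetric])
    also have "\<dots> = (\<Sum>j\<le>m. disk j (m - j) (cis z * of_real \<rho>) (cis (- z) * of_real \<rho>))"
      by (rule cheb_U_eq_sum_disk) (simp add: complex_eq_iff)
    also have "\<dots> = (\<Sum>j\<le>m. cis (real j * z - real (m - j) * z) * ?d j)"
      by (simp only: disk_scale[OF cc] disk_of_real Complex.DeMoivre cis_mult) simp
    finally have "?U z = (\<Sum>j\<le>m. cis (real j * z - real (m - j) * z) * ?d j * cis (of_int (int l - int k) * z))"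
      by (simp only: sum_distrib_right)
    also have "\<dots> = (\<Sum>j\<le>m. cis (of_int (2 * (int j - int k)) * z) * ?d j)"
    proof (rule sum.cong)
      fix j assume "j \<in> {..m}"
      then have "real j * z - real (m - j) * z + of_int (int l - int k) * z = of_int (2 * (int j - int k)) * z"
        by (simp add: m_def of_nat_diff algebra_simps)
      then show "cis (real j * z - real (m - j) * z) * ?d j * cis (of_int (int l - int k) * z)
         = cis (of_int (2 * (int j - int k)) * z) * ?d j"
        by (simp only: mult.assoc mult.commute[of "?d j"]) (simp only: mult.assoc[symmetric] cis_mult)
    qed simp
    finally show ?thesis .
  qed
  have "(?U has_integral (\<Sum>j\<le>m. (if 2 * (int j - int k) = 0 then 2 * pi else 0) * ?d j)) {-pi..pi}"
    unfolding U
    by (intro has_integral_sum has_integral_mult_left integral_cis_period[of _ "- pi", simplified]) auto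
  also have "(\<Sum>j\<le>m. (if 2 * (int j - int k) = 0 then 2 * pi else 0) * ?d j)
      = (\<Sum>j\<le>m. if k = j then 2 * pi * ?d k else 0)"
    by (rule sum.cong) auto
  also have "\<dots> = 2 * pi * ?d k"
    by (simp add: m_def)
  finally have I: "(?U has_integral (2 * pi * ?d k)) (cbox (-pi) pi)" by simp
  have "norm (2 * pi * ?d k) \<le> (real m + 1) * measure lborel (cbox (-pi) pi)"
  proof (rule has_integral_bound[OF _ I])
    fix z
    have "\<bar>\<rho> * cos z\<bar> \<le> 1 * 1"
      unfolding abs_mult using assms by (intro mult_mono) auto
    then show "norm (?U z) \<le> real m + 1"
      using abs_cheb_U_le[of "\<rho> * cos z" m] by (simp add: norm_mult)
  qed auto
  then show ?thesis by (simp add: norm_mult abs_mult m_def)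
qed

section \<open>The Gaussian transform of the Chebyshev series\<close>

definition gauss_shift :: "real \<Rightarrow> real \<Rightarrow> real \<Rightarrow> complex" where
  "gauss_shift t z y = exp (- ((complex_of_real y + \<i> * complex_of_real z)\<^sup>2 / complex_of_real (4 * t)))"

text \<open>Completing the square: the substitution \<open>y = 2tn + sqrt (2t) x\<close> turns the integrand into a constant
  times a standard Gaussian times a pure oscillation, so that the characteristic function of the
  normal distribution applies. The Gaussian factors in \<open>z\<close> cancel, and what remains is the
  frequency \<open>n\<close> amplified by \<open>exp (n\<^sup>2 t)\<close>.\<close>
lemma gauss_shift_has_integral:
  assumes t: "t > 0"
  shows "has_bochner_integral lborel (\<lambda>y. gauss_shift t z y * of_real (exp (n * y)))
           (of_real (sqrt (4 * pi * t) * exp (n\<^sup>2 * t)) * cis (- (n * z)))"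
proof -
  define c where "c = sqrt (2 * t)"
  have c: "c > 0" "c\<^sup>2 = 2 * t" unfolding c_def using t by auto
  define s where "s = - (z * c / (2 * t))"
  have s2: "s\<^sup>2 / 2 = z\<^sup>2 / (4 * t)"
    unfolding s_def using c t by (simp add: power_divide power_mult_distrib field_simps power2_eq_square)
  let ?K = "complex_of_real (exp (n\<^sup>2 * t + z\<^sup>2 / (4 * t)) * sqrt (2 * pi)) * cis (- (n * z))"
  have "integrable std_normal_distribution (\<lambda>x. iexp (s * x))"
    by (intro prob_space.integrable_iexp real_distribution.axioms(1) real_dist_normal_dist)
       (auto simp: borel_measurable_continuous_onI)
  moreover have "(LINT x|std_normal_distribution. iexp (s * x)) = of_real (exp (- (z\<^sup>2 / (4 * t))))"
    using fun_cong[OF char_std_normal_distribution, of s] unfolding char_def minus_divide_left[symmetric] s2 by simp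
  moreover have [measurable]: "(\<lambda>x. iexp (s * x)) \<in> borel_measurable borel"
    by (intro borel_measurable_continuous_onI continuous_intros)
  ultimately have "has_bochner_integral lborel (\<lambda>x. std_normal_density x *\<^sub>R iexp (s * x)) (of_real (exp (- (z\<^sup>2 / (4 * t)))))"
    unfolding has_bochner_integral_iff
    using integrable_density[of "\<lambda>x. iexp (s * x)" lborel std_normal_density]
      integral_density[of "\<lambda>x. iexp (s * x)" lborel std_normal_density]
    by simp
  then have "has_bochner_integral lborel (\<lambda>x. ?K * (std_normal_density x *\<^sub>R iexp (s * x)))
     (?K * of_real (exp (- (z\<^sup>2 / (4 * t)))))"
    by (rule has_bochner_integral_mult_right)
  also have "(\<lambda>x. ?K * (std_normal_density x *\<^sub>R iexp (s * x)))
      = (\<lambda>x. gauss_shift t z (2 * t * n + c * x) * of_real (exp (n * (2 * t * n + c * x))))"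
  proof
    fix x
    have 1: "- ((complex_of_real (2 * t * n + c * x) + \<i> * complex_of_real z)\<^sup>2 / complex_of_real (4 * t))
        + of_real (n * (2 * t * n + c * x))
       = of_real (n\<^sup>2 * t + z\<^sup>2 / (4 * t)) + \<i> * of_real (- (n * z)) + of_real (- x\<^sup>2 / 2) + \<i> * of_real (s * x)"
    proof -
      have tc: "t = c * c / 2" using c by (simp add: power2_eq_square)
      show ?thesis
        unfolding s_def tc using c(1) by (simp add: complex_eq_iff power2_eq_square field_simps)
    qed
    have "gauss_shift t z (2 * t * n + c * x) * of_real (exp (n * (2 * t * n + c * x)))
      = exp (- ((complex_of_real (2 * t * n + c * x) + \<i> * complex_of_real z)\<^sup>2 / complex_of_real (4 * t))
        + of_real (n * (2 * t * n + c * x)))"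
      by (simp only: gauss_shift_def exp_add exp_of_real)
    also have "\<dots> = of_real (exp (n\<^sup>2 * t + z\<^sup>2 / (4 * t))) * cis (- (n * z)) * of_real (exp (- x\<^sup>2 / 2)) * iexp (s * x)"
      unfolding 1 by (simp only: exp_add exp_of_real cis_conv_exp)
    also have "\<dots> = ?K * (std_normal_density x *\<^sub>R iexp (s * x))"
      by (simp add: std_normal_density_def scaleR_conv_of_real real_sqrt_mult)
    finally show "?K * (std_normal_density x *\<^sub>R iexp (s * x)) =
       gauss_shift t z (2 * t * n + c * x) * of_real (exp (n * (2 * t * n + c * x)))" ..
  qed
  also have "?K * of_real (exp (- (z\<^sup>2 / (4 * t)))) =
      (of_real (sqrt (4 * pi * t) * exp (n\<^sup>2 * t)) * cis (- (n * z))) /\<^sub>R \<bar>c\<bar>"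
  proof -
    have "sqrt (4 * pi * t) = sqrt (2 * pi) * c"
      unfolding c_def real_sqrt_mult[symmetric] by (simp add: field_simps)
    then show ?thesis
      using c by (simp add: exp_add exp_minus scaleR_conv_of_real field_simps)
  qed
  finally show ?thesis
    using c by (subst lborel_has_bochner_integral_real_affine_iff[of c _ _ "2 * t * n"]) auto
qed

lemma norm_gauss_shift: "norm (gauss_shift t z y) = exp (z\<^sup>2 / (4 * t)) * norm (gauss_shift t 0 y)"
  by (simp add: gauss_shift_def norm_exp_eq_Re exp_add[symmetric] power2_eq_square field_simps diff_divide_distrib)

lemma norm_gauss_shift_has_integral:
  assumes t: "t > 0"
  shows "has_bochner_integral lborel (\<lambda>y. norm (gauss_shift t 0 y) * exp (n * y)) (sqrt (4 * pi * t) * exp (n\<^sup>2 * t))"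
proof -
  have "has_bochner_integral lborel (\<lambda>y. Re (gauss_shift t 0 y * of_real (exp (n * y))))
      (Re (of_real (sqrt (4 * pi * t) * exp (n\<^sup>2 * t)) * cis (- (n * 0))))"
    using gauss_shift_has_integral[OF t, of 0 n]
    by (rule has_bochner_integral_bounded_linear[OF bounded_linear_Re])
  also have "(\<lambda>y. Re (gauss_shift t 0 y * of_real (exp (n * y)))) = (\<lambda>y. norm (gauss_shift t 0 y) * exp (n * y))"
    by (simp add: gauss_shift_def norm_exp_eq_Re fun_eq_iff exp_eq_polar)
  finally show ?thesis by simp
qed

text \<open>The sublaplacian acts by \<open>- decay_rate k l\<close> on \<open>disk k l\<close> of \<open>\<alpha>*\<close> and \<open>\<alpha>\<close>. With \<open>m = k + l\<close> and
  \<open>n = k - l\<close> it equals \<open>m (m + 2) - n\<^sup>2\<close>, the eigenvalue of \<open>- \<Delta>\<close> diminished by the one of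
  \<open>- Z\<^sup>2\<close>.\<close>
definition decay_rate :: "nat \<Rightarrow> nat \<Rightarrow> real" where
  "decay_rate k l = 4 * real k * real l + 2 * real (k + l)"

text \<open>The part of degree \<open>m\<close> of the kernel. With the conjugate as first argument, \<open>disk k l\<close> has frequency
  \<open>- (k - l)\<close> in \<open>z\<close>, which is the sign that the Gaussian integral of \<open>e\<^sup>(\<^sup>k\<^sup>-\<^sup>l\<^sup>)\<^sup>y\<close> produces.\<close>
definition heat_mode :: "real \<Rightarrow> nat \<Rightarrow> complex \<Rightarrow> complex" where
  "heat_mode t m \<alpha> = of_nat (m + 1) *
     (\<Sum>k\<le>m. of_real (exp (- decay_rate k (m - k) * t)) * disk k (m - k) (cnj \<alpha>) \<alpha>)"

lemma heat_mode_explicit: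
  "heat_mode t m \<alpha> = of_nat (m + 1) *
     (\<Sum>k\<le>m. of_real (exp (- (4 * real k * real (m - k) + 2 * real m) * t)) * disk k (m - k) (cnj \<alpha>) \<alpha>)"
  unfolding heat_mode_def by (intro arg_cong2[of _ _ _ _ "(*)"] sum.cong) (auto simp: decay_rate_def)

definition heat_series :: "real \<Rightarrow> complex \<Rightarrow> complex" where
  "heat_series t \<alpha> = (\<Sum>m. heat_mode t m \<alpha>)"

lemma disk_polar:
  "disk k l (cnj (of_real \<rho> * cis z)) (of_real \<rho> * cis z) = cis (- ((real k - real l) * z)) * of_real (disk k l \<rho> \<rho>)"
proof -
  have "disk k l (cnj (of_real \<rho> * cis z)) (of_real \<rho> * cis z) =
     disk k l (cis (- z) * of_real \<rho>) (cis z * of_real \<rho>)"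
    by (simp add: cis_cnj mult.commute)
  also have "\<dots> = cis (- z) ^ k * cis z ^ l * of_real (disk k l \<rho> \<rho>)"
    by (subst disk_scale) (auto simp: cis_mult disk_of_real)
  also have "cis (- z) ^ k * cis z ^ l = cis (- ((real k - real l) * z))"
    by (simp add: Complex.DeMoivre cis_mult algebra_simps)
  finally show ?thesis .
qed

lemma norm_disk_le:
  assumes "norm \<alpha> \<le> 1"
  shows "norm (disk k l (cnj \<alpha>) \<alpha>) \<le> real (k + l) + 1"
proof -
  have "norm (disk k l (cnj \<alpha>) \<alpha>) = \<bar>disk k l (norm \<alpha>) (norm \<alpha>)\<bar>"
    using disk_polar[of k l "norm \<alpha>" "Arg \<alpha>"]
    by (metis norm_mult norm_cis mult_1 norm_of_real rcis_cmod_Arg rcis_def)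
  then show ?thesis using abs_disk_diag_le[of "norm \<alpha>" k l] assms by simp
qed

text \<open>The smallest decay rates of degree \<open>m\<close> are those with \<open>k = 0\<close> or \<open>k = m\<close>, namely \<open>2m\<close>; this
  linear growth still dominates the polynomial bound on the disk polynomials.\<close>
lemma norm_heat_mode_le:
  assumes "norm \<alpha> \<le> 1" "t > 0"
  shows "norm (heat_mode t m \<alpha>) \<le> (real m + 1) ^ 3 * exp (- 2 * t * real m)"
proof -
  have "norm (of_real (exp (- (4 * real k * real (m - k) + 2 * real m) * t)) * disk k (m - k) (cnj \<alpha>) \<alpha>)
      \<le> exp (- 2 * t * real m) * (real m + 1)" if "k \<le> m" for k
    unfolding norm_mult
  proof (intro mult_mono)
    have "0 \<le> t * (real k * real (m - k))" using assms by simp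
    then show "norm (complex_of_real (exp (- (4 * real k * real (m - k) + 2 * real m) * t))) \<le> exp (- 2 * t * real m)"
      by (simp add: ring_distribs mult_ac)
    show "norm (disk k (m - k) (cnj \<alpha>) \<alpha>) \<le> real m + 1"
      using norm_disk_le[OF assms(1), of k "m - k"] that by simp
  qed auto
  then have "norm (\<Sum>k\<le>m. of_real (exp (- (4 * real k * real (m - k) + 2 * real m) * t)) * disk k (m - k) (cnj \<alpha>) \<alpha>)
     \<le> (\<Sum>k\<le>m. exp (- 2 * t * real m) * (real m + 1))"
    by (intro sum_norm_le) auto
  then have "norm (heat_mode t m \<alpha>) \<le> norm (of_nat (m + 1) :: complex) * (\<Sum>k\<le>m. exp (- 2 * t * real m) * (real m + 1))"
    unfolding heat_mode_explicit norm_mult by (intro mult_left_mono) auto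
  also have "norm (of_nat (m + 1) :: complex) = real m + 1"
    by (subst norm_of_nat) simp
  finally show ?thesis
    by (simp add: power3_eq_cube mult_ac add.commute)
qed

lemma summable_cube_exp:
  assumes "t > 0"
  shows "summable (\<lambda>m. (real m + 1) ^ 3 * exp (- 2 * t * real m))"
proof (rule summable_comparison_test_bigo)
  show "summable (\<lambda>m. norm (exp (- t) ^ m))"
    using assms by (simp add: summable_geometric)
  have "(\<lambda>m. (real m + 1) ^ 3 * exp (- 2 * t * real m)) \<in> O(\<lambda>m. exp (- t * real m))"
    using assms by real_asymp
  then show "(\<lambda>m. (real m + 1) ^ 3 * exp (- 2 * t * real m)) \<in> O(\<lambda>m. exp (- t) ^ m)"
    by (simp add: exp_of_nat_mult[symmetric] mult.commute)
qed

lemma heat_series_summable: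
  assumes "norm \<alpha> \<le> 1" "t > 0"
  shows "summable (\<lambda>m. heat_mode t m \<alpha>)"
  by (rule summable_comparison_test'[OF summable_cube_exp[OF assms(2)] norm_heat_mode_le[OF assms]])

text \<open>The series of \<open>q\<^sub>t\<close> may be integrated term by term: by the decomposition of \<open>U\<^sub>m(\<rho> cosh y)\<close> into
  exponentials \<open>e\<^sup>n\<^sup>y\<close> with \<open>\<bar>n\<bar> \<le> m\<close>, the \<open>L\<^sup>1\<close> norm of the term of degree \<open>m\<close> is at most a constant
  times \<open>(m + 1)\<^sup>3 exp (- 2mt)\<close>, the growth \<open>exp (n\<^sup>2 t)\<close> of the Gaussian integrals being absorbed by
  the factor \<open>exp (- m (m + 2) t)\<close>.\<close>
lemma gauss_transform_heat_q:
  assumes t: "t > 0" and \<rho>: "0 \<le> \<rho>" "\<rho> \<le> 1"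
  shows "integrable lborel (\<lambda>y. gauss_shift t z y * of_real (heat_q t (\<rho> * cosh y)))" (is ?int)
    and "heat_series t (of_real \<rho> * cis z) = of_real (1 / sqrt (4 * pi * t)) *
           (LINT y|lborel. gauss_shift t z y * of_real (heat_q t (\<rho> * cosh y)))" (is ?eq)
proof -
  define d where "d m k = disk k (m - k) \<rho> \<rho>" for m k
  define c where "c m = (real m + 1) * exp (- real m * (real m + 2) * t)" for m
  define w where "w m k = real k - real (m - k)" for m k
  define f where "f m y = gauss_shift t z y * of_real (c m * cheb_U m (\<rho> * cosh y))" for m y
  have c0: "c m \<ge> 0" for m unfolding c_def by simp
  have U: "cheb_U m (\<rho> * cosh y) = (\<Sum>k\<le>m. d m k * exp (w m k * y))" for m y
  proof -
    have "cheb_U m (\<rho> * cosh y) = (\<Sum>k\<le>m. disk k (m - k) (exp y * \<rho>) (exp (- y) * \<rho>))"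
      by (rule cheb_U_eq_sum_disk) (simp add: cosh_def algebra_simps)
    also have "\<dots> = (\<Sum>k\<le>m. d m k * exp (w m k * y))"
    proof (rule sum.cong)
      fix k
      have "disk k (m - k) (exp y * \<rho>) (exp (- y) * \<rho>) = exp y ^ k * exp (- y) ^ (m - k) * d m k"
        unfolding d_def by (rule disk_scale) (simp add: exp_minus_inverse)
      also have "exp y ^ k * exp (- y) ^ (m - k) = exp (w m k * y)"
        unfolding exp_of_nat_mult[symmetric] exp_add[symmetric] by (simp add: w_def algebra_simps)
      finally show "disk k (m - k) (exp y * \<rho>) (exp (- y) * \<rho>) = d m k * exp (w m k * y)"
        by simp
    qed simp
    finally show ?thesis .
  qed
  have f_eq: "f m y = (\<Sum>k\<le>m. of_real (c m * d m k) * (gauss_shift t z y * of_real (exp (w m k * y))))" for m y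
    unfolding f_def U sum_distrib_left of_real_sum by (intro sum.cong) (auto simp: mult_ac)
  \<comment> \<open>The exponents combine by \<open>m (m + 2) - (k - (m - k))\<^sup>2 = 4 k (m - k) + 2 m\<close>.\<close>
  have w2: "c m * exp ((w m k)\<^sup>2 * t) = (real m + 1) * exp (- (4 * real k * real (m - k) + 2 * real m) * t)"
    if "k \<le> m" for m k
  proof -
    have "- real m * (real m + 2) * t + (w m k)\<^sup>2 * t = - (4 * real k * real (m - k) + 2 * real m) * t"
      unfolding w_def using that by (simp add: of_nat_diff power2_eq_square algebra_simps)
    then show ?thesis unfolding c_def mult.assoc[of "real m + 1"] exp_add[symmetric] by simp
  qed
  have int_f: "has_bochner_integral lborel (f m) (of_real (sqrt (4 * pi * t)) * heat_mode t m (of_real \<rho> * cis z))" for m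
  proof -
    have "has_bochner_integral lborel (f m) (\<Sum>k\<le>m. of_real (c m * d m k) *
        (of_real (sqrt (4 * pi * t) * exp ((w m k)\<^sup>2 * t)) * cis (- (w m k * z))))"
      unfolding f_eq by (intro has_bochner_integral_sum has_bochner_integral_mult_right gauss_shift_has_integral t)
    also have "(\<Sum>k\<le>m. of_real (c m * d m k) *
        (of_real (sqrt (4 * pi * t) * exp ((w m k)\<^sup>2 * t)) * cis (- (w m k * z))))
        = of_real (sqrt (4 * pi * t)) * heat_mode t m (of_real \<rho> * cis z)"
      unfolding heat_mode_explicit sum_distrib_left
    proof (rule sum.cong)
      fix k assume "k \<in> {..m}"
      then have k: "k \<le> m" by simp
      have "of_real (c m * d m k) * (of_real (sqrt (4 * pi * t) * exp ((w m k)\<^sup>2 * t)) * cis (- (w m k * z)))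
        = of_real (sqrt (4 * pi * t)) * (of_real (c m * exp ((w m k)\<^sup>2 * t)) * (cis (- (w m k * z)) * of_real (d m k)))"
        by (simp add: mult_ac)
      also have "of_real (c m * exp ((w m k)\<^sup>2 * t)) =
          of_nat (m + 1) * complex_of_real (exp (- (4 * real k * real (m - k) + 2 * real m) * t))"
        unfolding w2[OF k] by simp
      also have "cis (- (w m k * z)) * of_real (d m k) = disk k (m - k) (cnj (of_real \<rho> * cis z)) (of_real \<rho> * cis z)"
        unfolding disk_polar w_def d_def ..
      finally show "complex_of_real (c m * d m k) *
           (complex_of_real (sqrt (4 * pi * t) * exp ((w m k)\<^sup>2 * t)) * cis (- (w m k * z))) =
          complex_of_real (sqrt (4 * pi * t)) *
          (of_nat (m + 1) * (complex_of_real (exp (- (4 * real k * real (m - k) + 2 * real m) * t)) *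
            disk k (m - k) (cnj (complex_of_real \<rho> * cis z)) (complex_of_real \<rho> * cis z)))"
        by (simp only: mult.assoc)
    qed simp
    finally show ?thesis .
  qed
  let ?B = "exp (z\<^sup>2 / (4 * t)) * sqrt (4 * pi * t)"
  have norm_f: "(LINT y|lborel. norm (f m y)) \<le> ?B * ((real m + 1) ^ 3 * exp (- 2 * t * real m))" for m
  proof -
    let ?g = "\<lambda>y. \<Sum>k\<le>m. (exp (z\<^sup>2 / (4 * t)) * (c m * (real m + 1))) * (norm (gauss_shift t 0 y) * exp (w m k * y))"
    have g: "has_bochner_integral lborel ?g
       (\<Sum>k\<le>m. (exp (z\<^sup>2 / (4 * t)) * (c m * (real m + 1))) * (sqrt (4 * pi * t) * exp ((w m k)\<^sup>2 * t)))"
      by (intro has_bochner_integral_sum has_bochner_integral_mult_right norm_gauss_shift_has_integral t)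
    have "(LINT y|lborel. norm (f m y)) \<le> (LINT y|lborel. ?g y)"
    proof (rule integral_mono)
      show "integrable lborel (\<lambda>y. norm (f m y))"
        using int_f by (auto intro: integrable_norm simp: has_bochner_integral_iff)
      show "integrable lborel ?g"
        using g by (simp only: has_bochner_integral_iff)
      fix y
      have "norm (of_real (c m * d m k) * (gauss_shift t z y * of_real (exp (w m k * y))))
        \<le> (exp (z\<^sup>2 / (4 * t)) * (c m * (real m + 1))) * (norm (gauss_shift t 0 y) * exp (w m k * y))"
        if "k \<le> m" for k
      proof -
        have "\<bar>d m k\<bar> \<le> real m + 1"
          using abs_disk_diag_le[OF \<rho>, of k "m - k"] that by (simp add: d_def)
        then have "c m * \<bar>d m k\<bar> * (exp (z\<^sup>2 / (4 * t)) * norm (gauss_shift t 0 y) * exp (w m k * y))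
          \<le> c m * (real m + 1) * (exp (z\<^sup>2 / (4 * t)) * norm (gauss_shift t 0 y) * exp (w m k * y))"
          using c0 by (intro mult_right_mono mult_left_mono) auto
        then show ?thesis
          using c0[of m] by (simp add: norm_mult abs_mult norm_gauss_shift[of t z] mult_ac)
      qed
      then show "norm (f m y) \<le> ?g y"
        unfolding f_eq by (intro sum_norm_le) auto
    qed
    also have "(LINT y|lborel. ?g y) = (\<Sum>k\<le>m. (exp (z\<^sup>2 / (4 * t)) * (c m * (real m + 1))) * (sqrt (4 * pi * t) * exp ((w m k)\<^sup>2 * t)))"
      using g by (rule has_bochner_integral_integral_eq)
    also have "\<dots> = (\<Sum>k\<le>m. ?B * (real m + 1) * (c m * exp ((w m k)\<^sup>2 * t)))"
      by (simp add: mult_ac)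
    also have "\<dots> \<le> (\<Sum>k\<le>m. ?B * (real m + 1) * ((real m + 1) * exp (- 2 * t * real m)))"
    proof (intro sum_mono mult_left_mono)
      fix k assume "k \<in> {..m}"
      then have "c m * exp ((w m k)\<^sup>2 * t) = (real m + 1) * exp (- (4 * real k * real (m - k) + 2 * real m) * t)"
        by (intro w2) simp
      also have "\<dots> \<le> (real m + 1) * exp (- 2 * t * real m)"
      proof -
        have "0 \<le> t * (real k * real (m - k))" using t by simp
        then show ?thesis
          by (intro mult_left_mono) (simp_all add: ring_distribs mult_ac)
      qed
      finally show "c m * exp ((w m k)\<^sup>2 * t) \<le> (real m + 1) * exp (- 2 * t * real m)" .
    qed (use t in auto)
    also have "\<dots> = ?B * ((real m + 1) ^ 3 * exp (- 2 * t * real m))"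
      by (simp add: power3_eq_cube algebra_simps)
    finally show ?thesis .
  qed
  have ptw: "summable (\<lambda>m. norm (f m y))" for y
  proof -
    have "summable (\<lambda>m. norm (gauss_shift t z y) * ((real m + 1) * exp (- real m * (real m + 2) * t) * (2 * norm (\<rho> * cosh y) + 1) ^ m))"
      by (intro summable_mult summable_heat_q_bound t) auto
    then show ?thesis
    proof (rule summable_comparison_test')
      fix m
      show "norm (norm (f m y)) \<le> norm (gauss_shift t z y) * ((real m + 1) * exp (- real m * (real m + 2) * t) * (2 * norm (\<rho> * cosh y) + 1) ^ m)"
        unfolding c_def[symmetric]
        using mult_left_mono[OF mult_left_mono[OF norm_cheb_U_le[of m "\<rho> * cosh y"] c0[of m]], of "norm (gauss_shift t z y)"]
        by (simp add: f_def norm_mult abs_mult c0)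
    qed
  qed
  have sum: "(\<Sum>m. f m y) = gauss_shift t z y * of_real (heat_q t (\<rho> * cosh y))" for y
  proof -
    have "(\<lambda>m. gauss_shift t z y * complex_of_real (c m * cheb_U m (\<rho> * cosh y))) sums
       (gauss_shift t z y * of_real (heat_q t (\<rho> * cosh y)))"
      using heat_q_summable[OF t, of "\<rho> * cosh y"]
      by (intro sums_mult sums_of_real) (simp add: heat_q_def c_def summable_sums)
    then show ?thesis unfolding f_def by (rule sums_unique[symmetric])
  qed
  have sn: "summable (\<lambda>m. LINT y|lborel. norm (f m y))"
    by (rule summable_comparison_test'[OF summable_mult[OF summable_cube_exp[OF t], of ?B]])
       (use norm_f in auto)
  have if': "integrable lborel (f m)" for m
    using int_f by (auto simp: has_bochner_integral_iff)
  have "integrable lborel (\<lambda>y. \<Sum>m. f m y)"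
    by (rule integrable_suminf[OF if' _ sn]) (use ptw in auto)
  then show ?int unfolding sum .
  have "(\<lambda>m. integral\<^sup>L lborel (f m)) sums (LINT y|lborel. (\<Sum>m. f m y))"
    by (rule sums_integral[OF if' _ sn]) (use ptw in auto)
  then have 1: "(\<lambda>m. of_real (sqrt (4 * pi * t)) * heat_mode t m (of_real \<rho> * cis z)) sums
       (LINT y|lborel. gauss_shift t z y * of_real (heat_q t (\<rho> * cosh y)))"
    unfolding sum has_bochner_integral_integral_eq[OF int_f] .
  have "(\<lambda>m. of_real (sqrt (4 * pi * t)) * heat_mode t m (of_real \<rho> * cis z)) sums
      (of_real (sqrt (4 * pi * t)) * heat_series t (of_real \<rho> * cis z))"
    unfolding heat_series_def using \<rho> t
    by (intro sums_mult summable_sums heat_series_summable) (auto simp: norm_mult)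
  from sums_unique2[OF this 1] show ?eq
    using t by (simp add: field_simps)
qed

section \<open>The sublaplacian on polynomial functions\<close>

definition frame :: "cmat set" where "frame = {su2_X, su2_Y, su2_Z}"

lemma mexp_frame:
  assumes "A \<in> frame"
  shows "mexp (s *\<^sub>R A) = cos s *\<^sub>R mat 1 + sin s *\<^sub>R A"
  by (rule mexp_rotation)
     (use assms in \<open>auto simp: frame_def vec_eq_iff forall_2 matrix_matrix_mult_def sum_2
        su2_X_def su2_Y_def su2_Z_def mat_def\<close>)

lemma mult_mexp_frame:
  assumes "A \<in> frame"
  shows "g ** mexp (s *\<^sub>R A) = cos s *\<^sub>R g + sin s *\<^sub>R (g ** A)"
  unfolding mexp_frame[OF assms]
  by (simp add: vec_eq_iff matrix_matrix_mult_def sum_2 forall_2 mat_def scaleR_conv_of_real[where 'a=complex] algebra_simps)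

lemma left_field_eqI:
  assumes "((\<lambda>s. f (g ** mexp (s *\<^sub>R A))) has_real_derivative d) (at 0)"
  shows "left_field A f g = d"
  unfolding left_field_def using assms by (rule DERIV_imp_deriv)

text \<open>Along \<open>exp (s A)\<close> a linear function \<open>f\<close> equals \<open>cos s f(g) + sin s f(g A)\<close>, so its derivative at
  \<open>s = 0\<close> is again linear in \<open>g\<close>; the product rule does the rest. Since this holds at every matrix \<open>g\<close>,
  not only on \<open>SU(2)\<close>, the derivatives can be iterated as functions on all matrices.\<close>
lemma real_polynomial_left_derivative:
  fixes f :: "cmat \<Rightarrow> real"
  assumes f: "real_polynomial_function f" and A: "A \<in> frame"
  obtains f' where "real_polynomial_function f'"
    "\<And>g. ((\<lambda>s. f (g ** mexp (s *\<^sub>R A))) has_real_derivative f' g) (at 0)"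
proof -
  have 0: "g ** mexp (0 *\<^sub>R A) = g" for g
    using mult_mexp_frame[OF A, of g 0] by simp
  have "\<exists>f'. real_polynomial_function f' \<and>
    (\<forall>g. ((\<lambda>s. f (g ** mexp (s *\<^sub>R A))) has_real_derivative f' g) (at 0))"
    using f
  proof (induction rule: real_polynomial_function.induct)
    case (linear f)
    note hyp = linear
    interpret bounded_linear f by fact
    have lin: "linear (\<lambda>g::cmat. g ** A)"
      by (rule linearI) (simp_all add: vec_eq_iff matrix_matrix_mult_def sum_2 scaleR_conv_of_real[where 'a=complex] algebra_simps)
    show ?case
    proof (intro exI conjI allI)
      show "real_polynomial_function (\<lambda>g. f (g ** A))"
        using bounded_linear_compose[OF hyp linear_conv_bounded_linear[THEN iffD1, OF lin]] by auto
      fix g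
      show "((\<lambda>s. f (g ** mexp (s *\<^sub>R A))) has_real_derivative f (g ** A)) (at 0)"
        unfolding mult_mexp_frame[OF A] add scaleR
        by (auto intro!: derivative_eq_intros)
    qed
  next
    case (const c)
    then show ?case by (intro exI[of _ "\<lambda>_. 0"]) auto
  next
    case (add f h)
    then obtain f' h' where "real_polynomial_function f'" "real_polynomial_function h'"
      "\<forall>g. ((\<lambda>s. f (g ** mexp (s *\<^sub>R A))) has_real_derivative f' g) (at 0)"
      "\<forall>g. ((\<lambda>s. h (g ** mexp (s *\<^sub>R A))) has_real_derivative h' g) (at 0)" by blast
    then show ?case
      by (intro exI[of _ "\<lambda>g. f' g + h' g"]) (auto intro!: derivative_intros)
  next
    case (mult f h)
    then obtain f' h' where "real_polynomial_function f'" "real_polynomial_function h'"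
      "\<forall>g. ((\<lambda>s. f (g ** mexp (s *\<^sub>R A))) has_real_derivative f' g) (at 0)"
      "\<forall>g. ((\<lambda>s. h (g ** mexp (s *\<^sub>R A))) has_real_derivative h' g) (at 0)" by blast
    then show ?case using mult.hyps
      by (intro exI[of _ "\<lambda>g. f' g * h g + h' g * f g"])
         (auto intro!: derivative_eq_intros simp: 0 simp del: scaleR_zero_left)
  qed
  then show thesis using that by blast
qed

lemma real_polynomial_left_field:
  fixes f :: "cmat \<Rightarrow> real"
  assumes "real_polynomial_function f" "A \<in> frame"
  shows "real_polynomial_function (left_field A f)"
proof -
  obtain f' where f': "real_polynomial_function f'"
    "\<And>g. ((\<lambda>s. f (g ** mexp (s *\<^sub>R A))) has_real_derivative f' g) (at 0)"
    using real_polynomial_left_derivative[OF assms] by blast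
  then have "left_field A f = f'" by (auto intro: left_field_eqI)
  with f' show ?thesis by simp
qed

lemma smooth_SU2_real_polynomial:
  assumes f: "real_polynomial_function f"
  shows "smooth_SU2 f"
  unfolding smooth_SU2_def frame_def[symmetric]
proof (intro allI impI conjI ballI)
  fix As assume As: "set As \<subseteq> frame"
  have P: "real_polynomial_function (foldr left_field As f)"
    using As by (induction As) (auto intro: f real_polynomial_left_field)
  show "continuous_on SU2 (foldr left_field As f)"
    by (intro continuous_at_imp_continuous_on ballI continuous_real_polymonial_function P)
  fix A g assume A: "A \<in> frame"
  show "(\<lambda>s. foldr left_field As f (g ** mexp (s *\<^sub>R A))) differentiable at 0"
    using real_polynomial_left_derivative[OF P A] by (metis differentiableI has_field_derivative_imp_has_derivative differentiable_def)
qed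

lemma real_polynomial_sublap:
  "real_polynomial_function f \<Longrightarrow> real_polynomial_function (sublap f)"
  unfolding sublap_def[abs_def]
  by (intro real_polynomial_function.intros(3) real_polynomial_left_field) (auto simp: frame_def)

text \<open>The real part is taken because the semigroup acts on real-valued functions; the
  complex coefficient \<open>c\<close> gives access to the imaginary part as well.\<close>
definition re_monomial :: "complex \<Rightarrow> nat \<Rightarrow> nat \<Rightarrow> nat \<Rightarrow> nat \<Rightarrow> cmat \<Rightarrow> real" where
  "re_monomial c p q k l g = Re (c * (g $ 1 $ 1) ^ p * cnj (g $ 1 $ 1) ^ q * (g $ 1 $ 2) ^ k * cnj (g $ 1 $ 2) ^ l)"

lemma re_monomial_curve_derivative:
  fixes a b a' b' :: complex
  shows "((\<lambda>s. Re (c * (cos s *\<^sub>R a + sin s *\<^sub>R a') ^ p * cnj (cos s *\<^sub>R a + sin s *\<^sub>R a') ^ q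
        * (cos s *\<^sub>R b + sin s *\<^sub>R b') ^ k * cnj (cos s *\<^sub>R b + sin s *\<^sub>R b') ^ l))
     has_real_derivative
       Re (of_nat p * c * a' * a ^ (p - 1) * cnj a ^ q * b ^ k * cnj b ^ l)
     + Re (of_nat q * c * cnj a' * a ^ p * cnj a ^ (q - 1) * b ^ k * cnj b ^ l)
     + Re (of_nat k * c * b' * a ^ p * cnj a ^ q * b ^ (k - 1) * cnj b ^ l)
     + Re (of_nat l * c * cnj b' * a ^ p * cnj a ^ q * b ^ k * cnj b ^ (l - 1))) (at 0)"
proof -
  let ?A = "\<lambda>s. cos s *\<^sub>R a + sin s *\<^sub>R a'" and ?B = "\<lambda>s. cos s *\<^sub>R b + sin s *\<^sub>R b'"
  have cs: "((\<lambda>s. cos s *\<^sub>R x + sin s *\<^sub>R y) has_vector_derivative y) (at 0)" for x y :: complex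
    by (auto intro!: derivative_eq_intros)
  have cnj: "((\<lambda>s. cnj (cos s *\<^sub>R x + sin s *\<^sub>R y)) has_vector_derivative cnj y) (at 0)" for x y :: complex
    using bounded_linear.has_vector_derivative[OF bounded_linear_cnj cs] .
  have pow: "((\<lambda>s. f s ^ n) has_vector_derivative (f' * (of_nat n * f 0 ^ (n - 1)))) (at 0)"
    if "(f has_vector_derivative f') (at 0)" for f :: "real \<Rightarrow> complex" and f' n
  proof -
    have "((\<lambda>x. x ^ n) has_field_derivative (of_nat n * f 0 ^ (n - 1))) (at (f 0))"
      by (auto intro!: derivative_eq_intros)
    from field_vector_diff_chain_at[OF that this] show ?thesis by (simp add: o_def)
  qed
  have "((\<lambda>s. c * ?A s ^ p * cnj (?A s) ^ q * ?B s ^ k * cnj (?B s) ^ l) has_vector_derivative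
       (of_nat p * c * a' * a ^ (p - 1) * cnj a ^ q * b ^ k * cnj b ^ l
      + of_nat q * c * cnj a' * a ^ p * cnj a ^ (q - 1) * b ^ k * cnj b ^ l
      + of_nat k * c * b' * a ^ p * cnj a ^ q * b ^ (k - 1) * cnj b ^ l
      + of_nat l * c * cnj b' * a ^ p * cnj a ^ q * b ^ k * cnj b ^ (l - 1))) (at 0)"
    by (rule has_vector_derivative_eq_rhs[OF has_vector_derivative_mult[OF has_vector_derivative_mult[OF
          has_vector_derivative_mult[OF has_vector_derivative_mult[OF has_vector_derivative_const
            pow[OF cs]] pow[OF cnj]] pow[OF cs]] pow[OF cnj]]])
       (simp add: algebra_simps)
  from bounded_linear.has_vector_derivative[OF bounded_linear_Re this]
  show ?thesis
    by (simp add: has_real_derivative_iff_has_vector_derivative)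
qed

lemma re_monomial_left_derivative_X:
  "((\<lambda>s. re_monomial c p q k l (g ** mexp (s *\<^sub>R su2_X))) has_real_derivative
       re_monomial (- of_nat p * c) (p - 1) q (k + 1) l g + re_monomial (- of_nat q * c) p (q - 1) k (l + 1) g
     + re_monomial (of_nat k * c) (p + 1) q (k - 1) l g + re_monomial (of_nat l * c) p (q + 1) k (l - 1) g) (at 0)"
proof -
  have "(g ** su2_X) $ 1 $ 1 = - (g $ 1 $ 2)" "(g ** su2_X) $ 1 $ 2 = g $ 1 $ 1"
    by (simp_all add: su2_X_def matrix_matrix_mult_def sum_2)
  then show ?thesis
    using re_monomial_curve_derivative[of c "g $ 1 $ 1" "(g ** su2_X) $ 1 $ 1" p q "g $ 1 $ 2" "(g ** su2_X) $ 1 $ 2" k l]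
    unfolding re_monomial_def mult_mexp_frame[of su2_X, unfolded frame_def, simplified]
    by (simp add: algebra_simps)
qed

lemma re_monomial_left_derivative_Y:
  "((\<lambda>s. re_monomial c p q k l (g ** mexp (s *\<^sub>R su2_Y))) has_real_derivative
       re_monomial (\<i> * of_nat p * c) (p - 1) q (k + 1) l g + re_monomial (- \<i> * of_nat q * c) p (q - 1) k (l + 1) g
     + re_monomial (\<i> * of_nat k * c) (p + 1) q (k - 1) l g + re_monomial (- \<i> * of_nat l * c) p (q + 1) k (l - 1) g) (at 0)"
proof -
  have "(g ** su2_Y) $ 1 $ 1 = \<i> * (g $ 1 $ 2)" "(g ** su2_Y) $ 1 $ 2 = \<i> * g $ 1 $ 1"
    by (simp_all add: su2_Y_def matrix_matrix_mult_def sum_2)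
  then show ?thesis
    using re_monomial_curve_derivative[of c "g $ 1 $ 1" "(g ** su2_Y) $ 1 $ 1" p q "g $ 1 $ 2" "(g ** su2_Y) $ 1 $ 2" k l]
    unfolding re_monomial_def mult_mexp_frame[of su2_Y, unfolded frame_def, simplified]
    by (simp add: algebra_simps)
qed

lemma re_monomial_scale_eq: "re_monomial (of_real x * c) p q k l g = x * re_monomial c p q k l g"
  by (simp add: re_monomial_def mult.assoc)

text \<open>As derivations, \<open>X\<close> sends \<open>(\<alpha>, \<beta>)\<close> to \<open>(- \<beta>, \<alpha>)\<close> and \<open>Y\<close> sends it to \<open>(i \<beta>, i \<alpha>)\<close>. In
  \<open>X\<^sup>2 + Y\<^sup>2\<close> all second-order terms cancel except those that pair \<open>\<alpha>\<close> with \<open>\<alpha>*\<close>, \<open>\<beta>\<close> with \<open>\<beta>*\<close>,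
  \<open>\<alpha>\<close> with \<open>\<beta>\<close>, or \<open>\<alpha>*\<close> with \<open>\<beta>*\<close>.\<close>
lemma sublap_re_monomial:
  "sublap (re_monomial c p q k 0) g = re_monomial (of_nat (4 * p * q) * c) (p - 1) (q - 1) (k + 1) 1 g
     - re_monomial (of_nat (4 * p * k + 2 * (p + q + k)) * c) p q k 0 g"
proof -
  have X: "left_field su2_X (re_monomial c p q k l) = (\<lambda>g.
       re_monomial (- of_nat p * c) (p - 1) q (k + 1) l g + re_monomial (- of_nat q * c) p (q - 1) k (l + 1) g
     + re_monomial (of_nat k * c) (p + 1) q (k - 1) l g + re_monomial (of_nat l * c) p (q + 1) k (l - 1) g)" for c p q k l
    by (rule ext left_field_eqI re_monomial_left_derivative_X)+
  have Y: "left_field su2_Y (re_monomial c p q k l) = (\<lambda>g.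
       re_monomial (\<i> * of_nat p * c) (p - 1) q (k + 1) l g + re_monomial (- \<i> * of_nat q * c) p (q - 1) k (l + 1) g
     + re_monomial (\<i> * of_nat k * c) (p + 1) q (k - 1) l g + re_monomial (- \<i> * of_nat l * c) p (q + 1) k (l - 1) g)" for c p q k l
    by (rule ext left_field_eqI re_monomial_left_derivative_Y)+
  note XX = left_field_eqI[OF DERIV_add[OF DERIV_add[OF DERIV_add[OF re_monomial_left_derivative_X re_monomial_left_derivative_X] re_monomial_left_derivative_X] re_monomial_left_derivative_X]]
  note YY = left_field_eqI[OF DERIV_add[OF DERIV_add[OF DERIV_add[OF re_monomial_left_derivative_Y re_monomial_left_derivative_Y] re_monomial_left_derivative_Y] re_monomial_left_derivative_Y]]
  have neg: "re_monomial (- c) p q k l g = - re_monomial c p q k l g" for c p q k l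
    by (simp add: re_monomial_def)
  have nat: "re_monomial (of_nat n * c) p q k l g = n * re_monomial c p q k l g" for n c p q k l
    using re_monomial_scale_eq[of "real n" c p q k l g] by simp
  have num: "re_monomial (numeral n * c) p q k l g = numeral n * re_monomial c p q k l g" for n c p q k l
    using re_monomial_scale_eq[of "numeral n" c p q k l g] by simp
  have ii: "\<i> * (\<i> * c) = - c" for c :: complex by (simp add: mult.assoc[symmetric])
  have ni: "of_nat n * (\<i> * c) = \<i> * (of_nat n * c)" for n and c :: complex by simp
  have vi: "numeral n * (\<i> * c) = \<i> * (numeral n * c)" for n and c :: complex by simp
  have add: "re_monomial (c + d) p q k l g = re_monomial c p q k l g + re_monomial d p q k l g" for c d p q k l
    by (simp add: re_monomial_def ring_distribs)
  have diff: "re_monomial (c - d) p q k l g = re_monomial c p q k l g - re_monomial d p q k l g" for c d p q k l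
    by (simp add: re_monomial_def ring_distribs)
  have zero: "re_monomial 0 p q k l g = 0" for p q k l
    by (simp add: re_monomial_def)
  show ?thesis
    unfolding sublap_def X Y XX YY
    \<comment> \<open>The case distinction resolves the truncated exponents \<open>p - 1\<close>, \<open>q - 1\<close>, \<open>k - 1\<close>.\<close>
    by (cases p; cases q; cases k)
       (simp_all add: neg nat num add diff zero mult.assoc ni vi ii ring_distribs)
qed

lemma SU2_entries:
  assumes "g \<in> SU2"
  shows "g $ 2 $ 1 = - cnj (g $ 1 $ 2)" "g $ 2 $ 2 = cnj (g $ 1 $ 1)"
    and "(g $ 1 $ 2) * cnj (g $ 1 $ 2) = 1 - (g $ 1 $ 1) * cnj (g $ 1 $ 1)"
proof -
  from assms have 1: "(g $ 1 $ 1) * cnj (g $ 1 $ 1) + (g $ 1 $ 2) * cnj (g $ 1 $ 2) = 1"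
    and 2: "(g $ 2 $ 1) * cnj (g $ 1 $ 1) + (g $ 2 $ 2) * cnj (g $ 1 $ 2) = 0"
    and 3: "(g $ 1 $ 1) * (g $ 2 $ 2) - (g $ 1 $ 2) * (g $ 2 $ 1) = 1"
    by (simp_all add: SU2_def vec_eq_iff forall_2 matrix_matrix_mult_def sum_2 mat_def det_2)
  show "(g $ 1 $ 2) * cnj (g $ 1 $ 2) = 1 - (g $ 1 $ 1) * cnj (g $ 1 $ 1)"
    using 1 by algebra
  show "g $ 2 $ 1 = - cnj (g $ 1 $ 2)"
    using 1 2 3 by algebra
  show "g $ 2 $ 2 = cnj (g $ 1 $ 1)"
    using 1 2 3 by algebra
qed

lemma SU2_norm_entry_le:
  assumes "g \<in> SU2"
  shows "norm (g $ 1 $ 1) \<le> 1" "norm (g $ 1 $ 2) \<le> 1"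
proof -
  have "complex_of_real ((norm (g $ 1 $ 1))\<^sup>2 + (norm (g $ 1 $ 2))\<^sup>2) = of_real 1"
    using SU2_entries(3)[OF assms] by (simp add: complex_norm_square del: of_real_power)
  then have 1: "(norm (g $ 1 $ 1))\<^sup>2 + (norm (g $ 1 $ 2))\<^sup>2 = 1" by (simp only: of_real_eq_iff)
  have "(norm (g $ 1 $ 1))\<^sup>2 \<le> 1\<^sup>2" "(norm (g $ 1 $ 2))\<^sup>2 \<le> 1\<^sup>2"
    using 1 by (metis add_increasing2 le_add_same_cancel1 one_power2 order_refl zero_le_power2 add.commute)+
  then show "norm (g $ 1 $ 1) \<le> 1" "norm (g $ 1 $ 2) \<le> 1"
    by (erule_tac power2_le_imp_le, simp)+
qed

text \<open>The relation \<open>\<beta> \<beta>* = 1 - \<alpha> \<alpha>*\<close> removes mixed powers of \<open>\<beta>\<close> and \<open>\<beta>*\<close>.\<close>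
lemma re_monomial_reduce:
  assumes "g \<in> SU2"
  shows "re_monomial c p q (Suc k) (Suc l) g = re_monomial c p q k l g - re_monomial c (Suc p) (Suc q) k l g"
proof -
  have "c * (g $ 1 $ 1) ^ p * cnj (g $ 1 $ 1) ^ q * (g $ 1 $ 2) ^ Suc k * cnj (g $ 1 $ 2) ^ Suc l
      = c * (g $ 1 $ 1) ^ p * cnj (g $ 1 $ 1) ^ q * (g $ 1 $ 2) ^ k * cnj (g $ 1 $ 2) ^ l
        * (g $ 1 $ 2 * cnj (g $ 1 $ 2))" by (simp add: mult_ac)
  also have "\<dots> = c * (g $ 1 $ 1) ^ p * cnj (g $ 1 $ 1) ^ q * (g $ 1 $ 2) ^ k * cnj (g $ 1 $ 2) ^ l
       - c * (g $ 1 $ 1) ^ Suc p * cnj (g $ 1 $ 1) ^ Suc q * (g $ 1 $ 2) ^ k * cnj (g $ 1 $ 2) ^ l"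
    unfolding SU2_entries(3)[OF assms] by (simp add: algebra_simps)
  finally show ?thesis unfolding re_monomial_def by simp
qed

lemma re_monomial_cnj: "re_monomial c p q k l g = re_monomial (cnj c) q p l k g"
proof -
  have "Re (cnj z) = Re z" for z by simp
  from this[of "c * (g $ 1 $ 1) ^ p * cnj (g $ 1 $ 1) ^ q * (g $ 1 $ 2) ^ k * cnj (g $ 1 $ 2) ^ l"]
  show ?thesis unfolding re_monomial_def by (simp add: mult_ac)
qed

text \<open>The triangular form of the sublaplacian. The truncated exponents \<open>p - 1\<close> and \<open>q - 1\<close> are harmless,
  because their coefficient vanishes when one of \<open>p\<close>, \<open>q\<close> is \<open>0\<close>.\<close>
lemma sublap_re_monomial_SU2:
  assumes "g \<in> SU2"
  shows "sublap (re_monomial c p q k 0) g = real (4 * p * q) * re_monomial c (p - 1) (q - 1) k 0 g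
     - real (4 * p * q + 4 * p * k + 2 * (p + q + k)) * re_monomial c p q k 0 g"
proof -
  have nat: "re_monomial (of_nat n * c) p q k l g = n * re_monomial c p q k l g" for n c p q k l
    using re_monomial_scale_eq[of "real n" c p q k l g] by simp
  show ?thesis
  proof (cases "p = 0 \<or> q = 0")
    case True
    then show ?thesis unfolding sublap_re_monomial nat by auto
  next
    case False
    then have "Suc (p - 1) = p" "Suc (q - 1) = q" by auto
    then have "re_monomial c (p - 1) (q - 1) (k + 1) 1 g = re_monomial c (p - 1) (q - 1) k 0 g - re_monomial c p q k 0 g"
      using re_monomial_reduce[OF assms, of c "p - 1" "q - 1" k 0] by simp
    then show ?thesis
      unfolding sublap_re_monomial nat by (simp only: of_nat_add ring_distribs)
  qed
qed

text \<open>Closed under agreement on \<open>SU(2)\<close>, so that a property which depends only on the values there can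
  be transferred by rule induction. Real multiples and zero are covered by the coefficients of the
  monomials.\<close>
inductive re_monomial_span :: "(cmat \<Rightarrow> real) \<Rightarrow> bool" where
  mono: "(\<And>g. g \<in> SU2 \<Longrightarrow> f g = re_monomial c p q k l g) \<Longrightarrow> re_monomial_span f"
| add: "re_monomial_span f \<Longrightarrow> re_monomial_span h \<Longrightarrow> (\<And>g. g \<in> SU2 \<Longrightarrow> e g = f g + h g) \<Longrightarrow> re_monomial_span e"

lemma re_monomial_mult:
  "re_monomial c p q k l g * re_monomial c' p' q' k' l' g
    = re_monomial (c * c' / 2) (p + p') (q + q') (k + k') (l + l') g
    + re_monomial (c * cnj c' / 2) (p + q') (q + p') (k + l') (l + k') g"
proof -
  have "Re z * Re w = Re (z * w / 2) + Re (z * cnj w / 2)" for z w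
    by (simp add: field_simps)
  note R = this[of "c * (g $ 1 $ 1) ^ p * cnj (g $ 1 $ 1) ^ q * (g $ 1 $ 2) ^ k * cnj (g $ 1 $ 2) ^ l"
      "c' * (g $ 1 $ 1) ^ p' * cnj (g $ 1 $ 1) ^ q' * (g $ 1 $ 2) ^ k' * cnj (g $ 1 $ 2) ^ l'"]
  show ?thesis unfolding re_monomial_def R by (simp add: power_add mult_ac)
qed

text \<open>Products of real parts are again sums of real parts, by \<open>Re z Re w = Re (z w) / 2 + Re (z w*) / 2\<close>.\<close>
lemma re_monomial_span_mult:
  assumes "re_monomial_span f" "re_monomial_span h"
  shows "re_monomial_span (\<lambda>g. f g * h g)"
  using assms
proof (induction arbitrary: h rule: re_monomial_span.induct)
  case (mono f c p q k l)
  from mono(2,1) show ?case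
  proof (induction rule: re_monomial_span.induct)
    case (mono h c' p' q' k' l')
    show ?case
    proof (rule re_monomial_span.add)
      show "re_monomial_span (re_monomial (c * c' / 2) (p + p') (q + q') (k + k') (l + l'))"
        "re_monomial_span (re_monomial (c * cnj c' / 2) (p + q') (q + p') (k + l') (l + k'))"
        by (auto intro: re_monomial_span.mono)
    qed (simp add: mono re_monomial_mult)
  next
    case (add h1 h2 e)
    show ?case
      by (rule re_monomial_span.add[OF add.IH(1) add.IH(2)]) (simp_all add: add algebra_simps)
  qed
next
  case (add f1 f2 e)
  show ?case
    by (rule re_monomial_span.add[OF add.IH(1)[OF add.prems] add.IH(2)[OF add.prems]]) (simp add: add algebra_simps)
qed

lemma re_monomial_span_real_polynomial:
  assumes "real_polynomial_function f"
  shows "re_monomial_span f"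
  using assms
proof (induction rule: real_polynomial_function.induct)
  case (linear f)
  then interpret bounded_linear f .
  define E where "E i j x = (\<chi> a b. if a = i \<and> b = j then x else (0 :: complex))" for i j :: 2 and x
  have dec: "g = (\<Sum>i\<in>UNIV. \<Sum>j\<in>UNIV. Re (g $ i $ j) *\<^sub>R E i j 1 + Im (g $ i $ j) *\<^sub>R E i j \<i>)" for g
    by (simp add: vec_eq_iff forall_2 E_def sum_2 complex_eq_iff)
  define C where "C i j = Complex (f (E i j 1)) (- f (E i j \<i>))" for i j
  have "f g = (\<Sum>i\<in>UNIV. \<Sum>j\<in>UNIV. Re (C i j * g $ i $ j))" for g
    by (subst dec[of g]) (simp add: sum add scaleR C_def mult.commute)
  then have f_eq: "f g = (re_monomial (C 1 1) 1 0 0 0 g + re_monomial (C 1 2) 0 0 1 0 g)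
       + (re_monomial (- C 2 1) 0 0 0 1 g + re_monomial (C 2 2) 0 1 0 0 g)" if "g \<in> SU2" for g
    using that by (simp add: sum_2 re_monomial_def SU2_entries)
  show ?case
    by (rule re_monomial_span.add[OF re_monomial_span.add re_monomial_span.add f_eq])
       (auto intro: re_monomial_span.mono)
next
  case (const c)
  show ?case
    by (rule re_monomial_span.mono[of _ "of_real c" 0 0 0 0]) (simp add: re_monomial_def)
qed (auto intro: re_monomial_span.add re_monomial_span_mult)

lemma real_polynomial_re_monomial: "real_polynomial_function (re_monomial c p q k l)"
proof -
  have "real_polynomial_function (\<lambda>g. Re (F g)) \<and> real_polynomial_function (\<lambda>g. Im (F g)) \<Longrightarrow>
        real_polynomial_function (\<lambda>g. Re (F g * G g)) \<and> real_polynomial_function (\<lambda>g. Im (F g * G g))"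
    if "real_polynomial_function (\<lambda>g. Re (G g)) \<and> real_polynomial_function (\<lambda>g. Im (G g))" for F G :: "cmat \<Rightarrow> complex"
    using that by (auto intro!: real_polynomial_function_diff real_polynomial_function.intros(3,4))
  note mult = this
  have entry: "bounded_linear (\<lambda>g::cmat. Re (g $ i $ j))" "bounded_linear (\<lambda>g::cmat. Im (g $ i $ j))" for i j
    by (intro bounded_linear_compose[OF bounded_linear_Re] bounded_linear_compose[OF bounded_linear_Im]
        bounded_linear_compose[OF bounded_linear_vec_nth] bounded_linear_vec_nth)+
  have ent: "real_polynomial_function (\<lambda>g. Re ((g::cmat) $ i $ j)) \<and> real_polynomial_function (\<lambda>g. Im (g $ i $ j))" for i j
    using entry by (auto intro: real_polynomial_function.intros(1))
  have entc: "real_polynomial_function (\<lambda>g. Re (cnj ((g::cmat) $ i $ j))) \<and> real_polynomial_function (\<lambda>g. Im (cnj (g $ i $ j)))" for i j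
    using ent[of i j] by (auto intro: real_polynomial_function_minus)
  have pow: "real_polynomial_function (\<lambda>g. Re (F g ^ n)) \<and> real_polynomial_function (\<lambda>g. Im (F g ^ n))"
    if F: "real_polynomial_function (\<lambda>g. Re (F g)) \<and> real_polynomial_function (\<lambda>g. Im (F g))" for F :: "cmat \<Rightarrow> complex" and n
  proof (induction n)
    case (Suc n)
    then show ?case unfolding power_Suc by (rule mult[OF _ F])
  qed auto
  have "real_polynomial_function (\<lambda>g. Re c) \<and> real_polynomial_function (\<lambda>g::cmat. Im c)" by auto
  then show ?thesis
    unfolding re_monomial_def[abs_def] by (intro mult[THEN conjunct1] mult pow ent entc)
qed

lemma compact_SU2: "compact SU2"
proof -
  have "closed SU2"
  proof -
    have eq: "SU2 = {A. A ** (\<chi> i j. cnj (A $ j $ i)) = mat 1} \<inter> {A. det A = 1}"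
      by (auto simp: SU2_def)
    show ?thesis
      unfolding eq matrix_matrix_mult_def det_2
      by (intro closed_Int closed_Collect_eq continuous_intros)
  qed
  moreover have "bounded SU2"
  proof (rule boundedI)
    fix g assume g: "g \<in> SU2"
    have "norm (g $ i $ j) \<le> 1" for i j
      using exhaust_2[of i] exhaust_2[of j] SU2_entries[OF g] SU2_norm_entry_le[OF g] by auto
    moreover have "norm (g $ i) \<le> norm (g $ i $ 1) + norm (g $ i $ 2)" for i
      using L2_set_le_sum[of UNIV "\<lambda>j. norm (g $ i $ j)"] by (simp add: norm_vec_def sum_2)
    ultimately have "norm (g $ i) \<le> 1 + 1" for i
      by (meson add_mono order_trans)
    moreover have "norm g \<le> norm (g $ 1) + norm (g $ 2)"
      using L2_set_le_sum[of UNIV "\<lambda>i. norm (g $ i)"] by (simp add: norm_vec_def sum_2)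
    ultimately show "norm g \<le> (1 + 1) + (1 + 1)"
      by (meson add_mono order_trans)
  qed
  ultimately show ?thesis by (simp add: compact_eq_bounded_closed)
qed

section \<open>The semigroup on monomials\<close>

text \<open>The value at the identity of \<open>P\<^sub>t\<close> applied to \<open>\<alpha>\<^sup>p \<alpha>*\<^sup>q\<close>. The summation index \<open>e\<close> labels the
  disk polynomial \<open>disk (p - e) (q - e)\<close> in the expansion of this monomial.\<close>
definition monomial_heat :: "nat \<Rightarrow> nat \<Rightarrow> real \<Rightarrow> real" where
  "monomial_heat p q t = (\<Sum>e\<le>min p q. (real (p + q + 1) - 2 * real e) * (fact p * fact q / (fact e * fact (p + q + 1 - e)))
       * exp (- decay_rate (p - e) (q - e) * t))"

text \<open>A telescoping sum: with \<open>N = p + q + 1\<close>,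
  \<open>(N - 2e) / (e! (N - e)!) = 1 / (e! (N - e - 1)!) - 1 / ((e - 1)! (N - e)!)\<close>.\<close>
lemma monomial_heat_0: "monomial_heat p q 0 = 1"
proof -
  define T where "T e = (if e = 0 then 0 else fact p * fact q / (fact (e - 1) * fact (p + q + 1 - e)) :: real)" for e
  have step: "(real (p + q + 1) - 2 * real e) * (fact p * fact q / (fact e * fact (p + q + 1 - e))) = T (Suc e) - T e"
    if "e \<le> min p q" for e
  proof -
    define n where "n = p + q - e"
    have n: "p + q + 1 - e = Suc n" "p + q = n + e"
      using that by (auto simp: n_def)
    show ?thesis
    proof (cases e)
      case 0
      then have "real (p + q + 1) = real (Suc n)" "fact (Suc n) = real (Suc n) * fact n" using n by simp_all
      then show ?thesis using n(1) unfolding T_def using 0 by (simp add: n(2) del: fact_Suc of_nat_Suc)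
    next
      case (Suc e')
      have id: "(b - a) * (A / ((a * F) * (b * G))) = A / ((a * F) * G) - A / (F * (b * G))"
        if "a > 0" "b > 0" "F > 0" "G > 0" for a b A F G :: real
        using that by (simp add: divide_simps) (simp add: algebra_simps)
      have 1: "real (p + q + 1) - 2 * real e = real (Suc n) - real (Suc e')"
        using n Suc by simp
      have 2: "fact e = real (Suc e') * fact e'" "fact (p + q + 1 - e) = real (Suc n) * fact n"
        unfolding n(1) unfolding Suc by (simp_all only: fact_Suc)
      have 3: "T (Suc e) = fact p * fact q / (real (Suc e') * fact e' * fact n)"
        "T e = fact p * fact q / (fact e' * (real (Suc n) * fact n))"
      proof -
        have "p + q + 1 - Suc e = n" using n(1) by simp
        then show "T (Suc e) = fact p * fact q / (real (Suc e') * fact e' * fact n)"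
          using 2(1) by (simp add: T_def mult_ac)
        show "T e = fact p * fact q / (fact e' * (real (Suc n) * fact n))"
          using 2(2) Suc by (simp add: T_def)
      qed
      show ?thesis unfolding 1 2 3 by (rule id) auto
    qed
  qed
  have tel: "(\<Sum>e\<le>n. T (Suc e) - T e) = T (Suc n) - T 0" for n
    by (induction n) auto
  have "monomial_heat p q 0 = (\<Sum>e\<le>min p q. T (Suc e) - T e)"
    unfolding monomial_heat_def using step by (intro sum.cong) auto
  also have "\<dots> = T (Suc (min p q)) - T 0"
    by (rule tel)
  also have "\<dots> = 1"
    by (auto simp: T_def min_def)
  finally show ?thesis .
qed

text \<open>The differential equation dictated by the triangular form of the sublaplacian for \<open>k = 0\<close>. It holds
  term by term since \<open>decay_rate p q - decay_rate (p - e) (q - e) = 4 e (p + q + 1 - e)\<close>.\<close>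
lemma monomial_heat_derivative:
  "((\<lambda>t. monomial_heat p q t) has_real_derivative
      - decay_rate p q * monomial_heat p q t + real (4 * p * q) * monomial_heat (p - 1) (q - 1) t) (at t)"
proof -
  define c where "c p q e = (real (p + q + 1) - 2 * real e) * (fact p * fact q / (fact e * fact (p + q + 1 - e)))" for p q e
  have mh: "monomial_heat p q t = (\<Sum>e\<le>min p q. c p q e * exp (- decay_rate (p - e) (q - e) * t))" for p q t
    unfolding monomial_heat_def c_def ..
  have "((\<lambda>t. monomial_heat p q t) has_real_derivative
      (\<Sum>e\<le>min p q. c p q e * (- decay_rate (p - e) (q - e) * exp (- decay_rate (p - e) (q - e) * t)))) (at t)"
    unfolding mh
    by (intro DERIV_sum DERIV_cmult) (auto intro!: derivative_eq_intros)
  also have "(\<Sum>e\<le>min p q. c p q e * (- decay_rate (p - e) (q - e) * exp (- decay_rate (p - e) (q - e) * t)))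
     = - decay_rate p q * monomial_heat p q t + (\<Sum>e\<le>min p q. (decay_rate p q - decay_rate (p - e) (q - e)) * c p q e * exp (- decay_rate (p - e) (q - e) * t))"
    unfolding mh sum_distrib_left sum.distrib[symmetric]
    by (intro sum.cong) (auto simp: algebra_simps)
  also have "(\<Sum>e\<le>min p q. (decay_rate p q - decay_rate (p - e) (q - e)) * c p q e * exp (- decay_rate (p - e) (q - e) * t))
     = real (4 * p * q) * monomial_heat (p - 1) (q - 1) t"
  proof (cases "min p q")
    case 0
    then show ?thesis by (auto simp: min_def split: if_splits)
  next
    case (Suc n)
    then have n: "n = min (p - 1) (q - 1)" "p \<ge> 1" "q \<ge> 1" by auto
    have *: "(decay_rate p q - decay_rate (p - Suc e) (q - Suc e)) * c p q (Suc e) = real (4 * p * q) * c (p - 1) (q - 1) e"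
      if "e \<le> n" for e
    proof -
      define P Q where "P = p - Suc e" and "Q = q - Suc e"
      have PQ: "p = P + Suc e" "q = Q + Suc e"
        using that n by (auto simp: P_def Q_def)
      have l: "decay_rate p q - decay_rate (p - Suc e) (q - Suc e) = 4 * real (Suc e) * (real P + real Q + real e + 2)"
        unfolding decay_rate_def PQ by (simp add: algebra_simps)
      have "p + q + 1 - Suc e = Suc (P + Q + e + 1)" using PQ by simp
      then have f0: "fact (p + q + 1 - Suc e) = (real P + real Q + real e + 2) * fact (P + Q + e + 1)"
        by (simp only: fact_Suc) simp
      have f: "fact (p + q + 1 - Suc e) = (real P + real Q + real e + 2) * fact (P + Q + e + 1)"
              "p - 1 + (q - 1) + 1 - e = P + Q + e + 1"
              "fact p = real p * fact (p - 1)" "fact q = real q * fact (q - 1)"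
        using PQ fact_reduce[of p] fact_reduce[of q] f0 by simp_all
      have "real P + real Q + real e + 2 > 0" by simp
      have r: "real (p - 1 + (q - 1) + 1) - 2 * real e = real (p + q + 1) - 2 * real (Suc e)"
        using PQ by simp
      show ?thesis
        unfolding c_def l f r using \<open>real P + real Q + real e + 2 > 0\<close>
        by (simp add: divide_simps)
    qed
    have "(\<Sum>e\<le>min p q. (decay_rate p q - decay_rate (p - e) (q - e)) * c p q e * exp (- decay_rate (p - e) (q - e) * t))
      = (\<Sum>e\<le>n. (decay_rate p q - decay_rate (p - Suc e) (q - Suc e)) * c p q (Suc e) * exp (- decay_rate (p - Suc e) (q - Suc e) * t))"
      unfolding Suc by (subst sum.atMost_Suc_shift) simp
    also have "\<dots> = (\<Sum>e\<le>n. real (4 * p * q) * (c (p - 1) (q - 1) e * exp (- decay_rate (p - 1 - e) (q - 1 - e) * t)))"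
    proof (rule sum.cong)
      fix e assume "e \<in> {..n}"
      then show "(decay_rate p q - decay_rate (p - Suc e) (q - Suc e)) * c p q (Suc e) * exp (- decay_rate (p - Suc e) (q - Suc e) * t)
         = real (4 * p * q) * (c (p - 1) (q - 1) e * exp (- decay_rate (p - 1 - e) (q - 1 - e) * t))"
        by (subst *) auto
    qed simp
    also have "\<dots> = real (4 * p * q) * monomial_heat (p - 1) (q - 1) t"
      unfolding mh sum_distrib_left n(1) ..
    finally show ?thesis .
  qed
  finally show ?thesis .
qed

lemma monomial_heat_commute: "monomial_heat p q t = monomial_heat q p t"
proof -
  have "decay_rate k l = decay_rate l k" for k l by (simp add: decay_rate_def)
  then show ?thesis
    unfolding monomial_heat_def add.commute[of q p] min.commute[of q p] mult.commute[of "fact q" "fact p"]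
    by (intro sum.cong refl) metis
qed

lemma exponential_decay_unique:
  fixes y :: "real \<Rightarrow> real"
  assumes der: "\<And>t. t > 0 \<Longrightarrow> (y has_real_derivative - a * y t) (at t)"
    and lim: "(y \<longlongrightarrow> 0) (at_right 0)" and t: "t > 0"
  shows "y t = 0"
proof -
  define u where "u t = exp (a * t) * y t" for t
  have "\<exists>c. \<forall>x\<in>{0<..}. u x = c"
  proof (rule has_field_derivative_zero_constant)
    fix x :: real assume "x \<in> {0<..}"
    then have "(u has_real_derivative 0) (at x)"
      unfolding u_def by (auto intro!: derivative_eq_intros der)
    then show "(u has_field_derivative 0) (at x within {0<..})"
      by (rule has_field_derivative_at_within)
  qed auto
  then obtain c where c: "\<And>x. x > 0 \<Longrightarrow> u x = c" by auto
  have "(u \<longlongrightarrow> exp (a * 0) * 0) (at_right 0)"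
    unfolding u_def by (intro tendsto_intros lim)
  moreover have "(u \<longlongrightarrow> c) (at_right 0)"
    by (rule tendsto_eventually) (auto simp: eventually_at_right_less c intro: eventually_at_rightI[of 0 1])
  ultimately have "c = 0"
    using tendsto_unique[of "at_right (0::real)" u] by force
  with c[OF t] show ?thesis by (simp add: u_def)
qed

lemma mat_1_in_SU2: "mat 1 \<in> SU2"
  by (simp add: SU2_def vec_eq_iff forall_2 matrix_matrix_mult_def sum_2 mat_def det_2)

lemma continuous_on_real_polynomial:
  "real_polynomial_function f \<Longrightarrow> continuous_on S f"
  by (intro continuous_at_imp_continuous_on ballI continuous_real_polymonial_function)

lemma C0_contraction_semigroupD:
  assumes "C0_contraction_semigroup P"
  shows semigroup_continuous: "t \<ge> 0 \<Longrightarrow> continuous_on SU2 f \<Longrightarrow> continuous_on SU2 (P t f)"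
    and semigroup_linear: "t \<ge> 0 \<Longrightarrow> continuous_on SU2 f \<Longrightarrow> continuous_on SU2 h \<Longrightarrow> g \<in> SU2 \<Longrightarrow>
        P t (\<lambda>x. a * f x + b * h x) g = a * P t f g + b * P t h g"
    and semigroup_contraction: "t \<ge> 0 \<Longrightarrow> continuous_on SU2 f \<Longrightarrow> (\<And>x. x \<in> SU2 \<Longrightarrow> \<bar>f x\<bar> \<le> M) \<Longrightarrow> g \<in> SU2 \<Longrightarrow>
        \<bar>P t f g\<bar> \<le> M"
    and semigroup_add: "s \<ge> 0 \<Longrightarrow> t \<ge> 0 \<Longrightarrow> continuous_on SU2 f \<Longrightarrow> g \<in> SU2 \<Longrightarrow> P (s + t) f g = P s (P t f) g"
    and semigroup_strongly_continuous: "continuous_on SU2 f \<Longrightarrow> uniform_limit SU2 (\<lambda>t. P t f) f (at_right 0)"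
  using assms unfolding C0_contraction_semigroup_def by simp_all

text \<open>Only the values on \<open>SU(2)\<close> matter: the contraction property with bound \<open>0\<close>, applied to the
  difference.\<close>
lemma semigroup_cong:
  assumes P: "C0_contraction_semigroup P" and "continuous_on SU2 f" "continuous_on SU2 h"
    and eq: "\<And>g. g \<in> SU2 \<Longrightarrow> f g = h g" and "t \<ge> 0" "g \<in> SU2"
  shows "P t f g = P t h g"
proof -
  let ?d = "\<lambda>x. 1 * f x + (-1) * h x"
  have d: "continuous_on SU2 ?d" using assms by (intro continuous_intros)
  then have "\<bar>P t ?d g\<bar> \<le> 0"
    using eq by (intro semigroup_contraction[OF P \<open>t \<ge> 0\<close> d _ \<open>g \<in> SU2\<close>]) auto
  moreover have "P t ?d g = 1 * P t f g + (-1) * P t h g"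
    by (rule semigroup_linear) fact+
  ultimately show ?thesis by simp
qed

text \<open>Contractivity carries the approximation of the generator at time \<open>0\<close> to every later time \<open>s\<close>,
  uniformly in \<open>s\<close>.\<close>
lemma semigroup_difference_quotient:
  assumes P: "C0_contraction_semigroup P" and f: "continuous_on SU2 f" and l: "continuous_on SU2 l"
    and h: "h > 0" and s: "s \<ge> 0" and g: "g \<in> SU2"
    and b: "\<And>x. x \<in> SU2 \<Longrightarrow> \<bar>(P h f x - f x) / h - l x\<bar> \<le> e"
  shows "\<bar>(P (s + h) f g - P s f g) / h - P s l g\<bar> \<le> e"
proof -
  have cont: "continuous_on SU2 (P h f)"
    using h by (intro semigroup_continuous[OF P _ f]) auto
  have lin: "P s (\<lambda>x. a * f x + b * h x) g = a * P s f g + b * P s h g"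
    if "continuous_on SU2 f" "continuous_on SU2 h" for a b f h
    by (rule semigroup_linear[OF P s that g])
  have semi: "P (s + h) f g = P s (P h f) g"
    using h by (intro semigroup_add[OF P s _ f g]) auto
  define u where "u = (\<lambda>x. (1 / h) * P h f x + (- (1 / h)) * f x)"
  define v where "v = (\<lambda>x. 1 * u x + (-1) * l x)"
  have cu: "continuous_on SU2 u" unfolding u_def by (intro continuous_intros cont f)
  have cv: "continuous_on SU2 v" unfolding v_def by (intro continuous_intros cu l)
  have "\<bar>v x\<bar> \<le> e" if "x \<in> SU2" for x
    using b[OF that] by (simp add: u_def v_def field_simps diff_divide_distrib)
  then have "\<bar>P s v g\<bar> \<le> e"
    using g by (intro semigroup_contraction[OF P s cv])
  also have "P s v g = (1 / h) * P s (P h f) g + (- (1 / h)) * P s f g - P s l g"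
    unfolding v_def lin[OF cu l] unfolding u_def lin[OF cont f] by simp
  finally show ?thesis unfolding semi by (simp add: diff_divide_distrib)
qed

text \<open>For negative increments the quotient is based at \<open>t - h\<close> and approximates \<open>P\<^sub>t\<^sub>-\<^sub>h l\<close> instead of
  \<open>P\<^sub>t l\<close>; strong continuity, applied to \<open>l\<close>, closes the gap.\<close>
lemma semigroup_derivative:
  assumes P: "C0_contraction_semigroup P" and f: "continuous_on SU2 f" and l: "continuous_on SU2 l"
    and gen: "uniform_limit SU2 (\<lambda>t g. (P t f g - f g) / t) l (at_right 0)"
    and t: "t > 0" and g: "g \<in> SU2"
  shows "((\<lambda>s. P s f g) has_real_derivative P t l g) (at t)"
  unfolding DERIV_def LIM_def
proof (intro allI impI)
  fix e :: real assume e: "e > 0"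
  have "uniform_limit SU2 (\<lambda>t. P t l) l (at_right 0)"
    using P l by (rule semigroup_strongly_continuous)
  from uniform_limitD[OF this, of "e/3"] uniform_limitD[OF gen, of "e/3"] e
  have "\<forall>\<^sub>F h in at_right 0. (\<forall>x\<in>SU2. \<bar>P h l x - l x\<bar> < e/3) \<and> (\<forall>x\<in>SU2. \<bar>(P h f x - f x) / h - l x\<bar> < e/3)"
    by (simp add: dist_real_def eventually_conj_iff)
  then obtain d where d: "d > 0" and
    d1: "\<And>h x. 0 < h \<Longrightarrow> h < d \<Longrightarrow> x \<in> SU2 \<Longrightarrow> \<bar>P h l x - l x\<bar> < e/3" and
    d2: "\<And>h x. 0 < h \<Longrightarrow> h < d \<Longrightarrow> x \<in> SU2 \<Longrightarrow> \<bar>(P h f x - f x) / h - l x\<bar> < e/3"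
    unfolding eventually_at_right[OF zero_less_one] by (metis greaterThan_iff)
  show "\<exists>s>0. \<forall>x::real. x \<noteq> 0 \<and> dist x 0 < s \<longrightarrow> dist ((P (t + x) f g - P t f g) / x) (P t l g) < e"
  proof (intro exI[of _ "min d t"] conjI allI impI)
    fix x :: real assume x: "x \<noteq> 0 \<and> dist x 0 < min d t"
    show "dist ((P (t + x) f g - P t f g) / x) (P t l g) < e"
    proof (cases "x > 0")
      case True
      then have "\<bar>(P (t + x) f g - P t f g) / x - P t l g\<bar> \<le> e/3"
        using x t d2 by (intro semigroup_difference_quotient[OF P f l _ _ g]) (auto intro: less_imp_le)
      then show ?thesis using e by (simp add: dist_real_def)
    next
      case False
      define h where "h = - x"
      have h: "0 < h" "h < d" "h < t" using x False by (auto simp: h_def dist_real_def)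
      have 1: "\<bar>(P (t - h + h) f g - P (t - h) f g) / h - P (t - h) l g\<bar> \<le> e/3"
        using h d2 by (intro semigroup_difference_quotient[OF P f l _ _ g]) (auto intro: less_imp_le)
      \<comment> \<open>The bound on \<open>P\<^sub>t l - P\<^sub>t\<^sub>-\<^sub>h l\<close> comes from \<open>semigroup_difference_quotient\<close> with the zero
        function in place of the generator value.\<close>
      have "\<bar>(P (t - h + h) l g - P (t - h) l g) / h - P (t - h) (\<lambda>_. 0) g\<bar> \<le> e / 3 / h"
      proof (intro semigroup_difference_quotient[OF P l _ _ _ g])
        fix x assume "x \<in> SU2"
        from divide_right_mono[OF less_imp_le[OF d1[OF h(1,2) this]], of h]
        show "\<bar>(P h l x - l x) / h - 0\<bar> \<le> e / 3 / h"
          using h by (simp add: abs_divide)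
      qed (use h in auto)
      moreover have "P (t - h) (\<lambda>_. 0) g = 0"
      proof -
        have "\<bar>P (t - h) (\<lambda>_. 0) g\<bar> \<le> 0"
          by (rule semigroup_contraction[OF P _ _ _ g]) (use h in auto)
        then show ?thesis by simp
      qed
      ultimately have 2: "\<bar>P t l g - P (t - h) l g\<bar> \<le> e / 3"
        using h by (simp add: abs_divide field_simps)
      have "(P (t + x) f g - P t f g) / x = (P t f g - P (t - h) f g) / h"
        using h by (simp add: h_def field_simps)
      moreover have "\<bar>(P t f g - P (t - h) f g) / h - P (t - h) l g\<bar> \<le> e/3"
        using 1 by simp
      ultimately show ?thesis
        using 2 e unfolding dist_real_def by linarith
    qed
  qed (use d t in auto)
qed

text \<open>Induction along the triangular form. The difference between the two sides satisfies
  \<open>y' = - \<mu> y\<close> for \<open>t > 0\<close> and tends to \<open>0\<close> as \<open>t\<close> decreases to \<open>0\<close>, because \<open>\<alpha>\<^sup>p \<alpha>*\<^sup>q \<beta>\<^sup>k\<close> at the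
  identity is \<open>1\<close> for \<open>k = 0\<close> and \<open>0\<close> otherwise.\<close>
lemma semigroup_re_monomial:
  assumes P: "subelliptic_heat_semigroup P" and t: "t > 0"
  shows "P t (re_monomial c p q k 0) (mat 1) = (if k = 0 then Re c * monomial_heat p q t else 0)"
  using t
proof (induction p arbitrary: q t rule: less_induct)
  case (less p)
  have C0: "C0_contraction_semigroup P"
    using P unfolding subelliptic_heat_semigroup_def by blast
  define \<kappa> where "\<kappa> = (if k = 0 then Re c else 0)"
  define \<mu> where "\<mu> = real (4 * p * q + 4 * p * k + 2 * (p + q + k))"
  let ?M = "re_monomial c p q k 0" and ?M' = "re_monomial c (p - 1) (q - 1) k 0"
  have cont: "continuous_on SU2 (re_monomial c p q k l)" for c p q k l
    by (intro continuous_on_real_polynomial real_polynomial_re_monomial)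
  have contL: "continuous_on SU2 (sublap ?M)"
    by (intro continuous_on_real_polynomial real_polynomial_sublap real_polynomial_re_monomial)
  have "is_generator_value P ?M (sublap ?M)"
  proof -
    have "(\<forall>n::nat. smooth_SU2 ((\<lambda>_. ?M) n)) \<and> uniform_limit SU2 (\<lambda>_. ?M) ?M sequentially \<and>
             uniform_limit SU2 (\<lambda>n. sublap ((\<lambda>_. ?M) n)) (sublap ?M) sequentially"
      by (auto intro: smooth_SU2_real_polynomial real_polynomial_re_monomial uniform_limit_const)
    then show ?thesis
      using P[unfolded subelliptic_heat_semigroup_def, THEN conjunct2, rule_format, THEN iffD2, OF exI[of _ "\<lambda>_. ?M"]] by blast
  qed
  then have gen: "uniform_limit SU2 (\<lambda>t g. (P t ?M g - ?M g) / t) (sublap ?M) (at_right 0)"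
    unfolding is_generator_value_def by blast
  have der: "((\<lambda>s. P s ?M (mat 1)) has_real_derivative real (4 * p * q) * P t ?M' (mat 1) - \<mu> * P t ?M (mat 1)) (at t)"
    if "t > 0" for t
  proof -
    have "sublap ?M g = real (4 * p * q) * ?M' g + (- \<mu>) * ?M g" if "g \<in> SU2" for g
      unfolding sublap_re_monomial_SU2[OF that] \<mu>_def by (simp only: mult_minus_left diff_conv_add_uminus)
    then have "P t (sublap ?M) (mat 1) = P t (\<lambda>g. real (4 * p * q) * ?M' g + (- \<mu>) * ?M g) (mat 1)"
      using that by (intro semigroup_cong[OF C0 contL]) (auto intro!: continuous_intros cont mat_1_in_SU2)
    also have "\<dots> = real (4 * p * q) * P t ?M' (mat 1) + (- \<mu>) * P t ?M (mat 1)"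
      by (rule semigroup_linear[OF C0 _ cont cont mat_1_in_SU2]) (use that in auto)
    finally show ?thesis
      using semigroup_derivative[OF C0 cont contL gen that mat_1_in_SU2] by simp
  qed
  have IH: "real (4 * p * q) * P t ?M' (mat 1) = real (4 * p * q) * (\<kappa> * monomial_heat (p - 1) (q - 1) t)" if "t > 0" for t
    using less.IH[of "p - 1" t "q - 1"] that by (cases "p = 0") (auto simp: \<kappa>_def)
  define y where "y t = P t ?M (mat 1) - \<kappa> * monomial_heat p q t" for t
  have "y t = 0"
  proof (rule exponential_decay_unique[OF _ _ less.prems])
    fix t :: real assume t: "t > 0"
    have "(y has_real_derivative (real (4 * p * q) * P t ?M' (mat 1) - \<mu> * P t ?M (mat 1))
       - \<kappa> * (- decay_rate p q * monomial_heat p q t + real (4 * p * q) * monomial_heat (p - 1) (q - 1) t)) (at t)"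
      unfolding y_def by (intro DERIV_diff DERIV_cmult der t monomial_heat_derivative)
    also have "(real (4 * p * q) * P t ?M' (mat 1) - \<mu> * P t ?M (mat 1))
       - \<kappa> * (- decay_rate p q * monomial_heat p q t + real (4 * p * q) * monomial_heat (p - 1) (q - 1) t) = - \<mu> * y t"
      unfolding IH[OF t] by (auto simp: y_def \<kappa>_def \<mu>_def decay_rate_def algebra_simps)
    finally show "(y has_real_derivative - \<mu> * y t) (at t)" .
  next
    have "uniform_limit SU2 (\<lambda>t. P t ?M) ?M (at_right 0)"
      by (rule semigroup_strongly_continuous[OF C0 cont])
    then have "((\<lambda>t. P t ?M (mat 1)) \<longlongrightarrow> ?M (mat 1)) (at_right 0)"
      by (rule tendsto_uniform_limitI[OF _ mat_1_in_SU2])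
    moreover have "(monomial_heat p q \<longlongrightarrow> monomial_heat p q 0) (at_right 0)"
      using DERIV_isCont[OF monomial_heat_derivative[of p q 0]] by (auto simp: isCont_def intro: filterlim_at_split[THEN iffD1, THEN conjunct2])
    ultimately have "(y \<longlongrightarrow> ?M (mat 1) - \<kappa> * monomial_heat p q 0) (at_right 0)"
      unfolding y_def by (intro tendsto_intros)
    also have "?M (mat 1) - \<kappa> * monomial_heat p q 0 = 0"
      by (auto simp: monomial_heat_0 \<kappa>_def re_monomial_def mat_def)
    finally show "(y \<longlongrightarrow> 0) (at_right 0)" .
  qed
  then show ?case by (auto simp: y_def \<kappa>_def)
qed

section \<open>Haar integrals of monomials against the series\<close>

lemma cos_power_sin_2_has_integral:
  "((\<lambda>r. cos r ^ n * sin (2 * r)) has_integral 2 / (real n + 2)) {0..pi/2}"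
proof -
  have "((\<lambda>r. cos r ^ n * sin (2 * r)) has_integral
     (- 2 * cos (pi/2) ^ (n + 2) / (real n + 2) - (- 2 * cos 0 ^ (n + 2) / (real n + 2)))) {0..pi/2}"
  proof (rule fundamental_theorem_of_calculus)
    fix x :: real
    have pow: "((\<lambda>r. cos r ^ (n + 2)) has_real_derivative real (n + 2) * (cos x ^ (n + 1) * (- sin x))) (at x within {0..pi/2})"
      using DERIV_power[OF DERIV_subset[OF DERIV_cos subset_UNIV], of "n + 2" x "{0..pi/2}"] by (simp add: mult_ac)
    have "((\<lambda>r. - 2 * cos r ^ (n + 2) / (real n + 2)) has_real_derivative
      (- 2 * (real (n + 2) * (cos x ^ (n + 1) * (- sin x))) / (real n + 2))) (at x within {0..pi/2})"
      by (intro DERIV_cdivide DERIV_cmult pow)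
    also have "- 2 * (real (n + 2) * (cos x ^ (n + 1) * (- sin x))) / (real n + 2) = cos x ^ n * sin (2 * x)"
    proof -
      have "real (n + 2) = real n + 2" "real n + 2 \<noteq> 0" by simp_all
      then show ?thesis unfolding sin_double by (simp add: field_simps)
    qed
    finally show "((\<lambda>r. - 2 * cos r ^ (n + 2) / (real n + 2)) has_vector_derivative cos x ^ n * sin (2 * x)) (at x within {0..pi/2})"
      by (simp add: has_real_derivative_iff_has_vector_derivative)
  qed auto
  then show ?thesis by simp
qed

text \<open>The moment of \<open>disk k l\<close> against \<open>cos\<^sup>p\<^sup>+\<^sup>q r\<close> in the case \<open>p - q = k - l\<close>. Its vanishing for \<open>p < k\<close>
  is the orthogonality of the disk polynomials to monomials of lower degree and equal frequency.\<close>
definition radial_moment :: "nat \<Rightarrow> nat \<Rightarrow> nat \<Rightarrow> nat \<Rightarrow> real" where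
  "radial_moment k l p q = (if k \<le> p then fact p * fact q / (fact (p - k) * fact (p + l + 1)) else 0)"

lemma radial_moment_rec:
  assumes "p + l = q + k"
  shows "radial_moment k (Suc l) p (Suc q) + radial_moment (Suc k) l (Suc p) q - radial_moment k l p q = radial_moment (Suc k) (Suc l) p q"
proof (cases "k \<le> p")
  case True
  define f where "f = p - k"
  have p: "p = k + f" "q = l + f" using True assms by (auto simp: f_def)
  have id: "Q * A * B / (F * (N * M)) + P * A * B / (F * (N * M)) - A * B / (F * M) = (Q + P - N) * (A * B) / (F * (N * M))"
    if "N > 0" "M > 0" "F > 0" for A B F M N P Q :: real
    using that by (simp add: divide_simps) (simp add: algebra_simps)
  have *: "radial_moment k (Suc l) p (Suc q) + radial_moment (Suc k) l (Suc p) q - radial_moment k l p q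
      = (real (Suc q) + real (Suc p) - real (p + l + 2)) * (fact p * fact q) / (fact f * (real (p + l + 2) * fact (p + l + 1)))"
  proof -
    have n: "p + Suc l + 1 = Suc (p + l + 1)" "Suc p + l + 1 = Suc (p + l + 1)" "Suc p - Suc k = f" "p - k = f"
      using p by simp_all
    have 1: "radial_moment k (Suc l) p (Suc q) = real (Suc q) * fact p * fact q / (fact f * (real (p + l + 2) * fact (p + l + 1)))"
      unfolding radial_moment_def n using True by (simp add: mult_ac)
    have 2: "radial_moment (Suc k) l (Suc p) q = real (Suc p) * fact p * fact q / (fact f * (real (p + l + 2) * fact (p + l + 1)))"
      unfolding radial_moment_def n using True by (simp add: mult_ac)
    have 3: "radial_moment k l p q = fact p * fact q / (fact f * fact (p + l + 1))"
      unfolding radial_moment_def n using True by simp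
    show ?thesis unfolding 1 2 3 by (rule id) auto
  qed
  have "real (Suc q) + real (Suc p) - real (p + l + 2) = real f"
    using p by simp
  note * = *[unfolded this]
  show ?thesis
  proof (cases f)
    case 0
    then show ?thesis unfolding * using p by (simp add: radial_moment_def)
  next
    case (Suc g)
    then have "Suc k \<le> p" "p - Suc k = g" "p + Suc l + 1 = Suc (p + l + 1)" using p by auto
    then have "radial_moment (Suc k) (Suc l) p q = fact p * fact q / (fact g * (real (p + l + 2) * fact (p + l + 1)))"
      unfolding radial_moment_def by simp
    moreover have "fact f = real f * fact g" "real f > 0" using Suc by auto
    ultimately show ?thesis unfolding * by (simp del: of_nat_add fact_Suc of_nat_Suc)
  qed
qed (auto simp: radial_moment_def)

text \<open>In the recursion of \<open>disk\<close> a factor \<open>cos r\<close> is moved to the monomial, raising \<open>q\<close> or \<open>p\<close> according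
  to the change of frequency; the closed form satisfies the resulting recursion by
  \<open>radial_moment_rec\<close>.\<close>
lemma disk_moment:
  assumes "p + l = q + k"
  shows "((\<lambda>r. disk k l (cos r) (cos r) * cos r ^ (p + q) * sin (2 * r)) has_integral radial_moment k l p q) {0..pi/2}"
  using assms
proof (induction k arbitrary: l p q)
  case 0
  have "2 / (real (l + (p + q)) + 2) = radial_moment 0 l p q"
  proof -
    have q: "q = p + l" using 0 by simp
    have "real (l + (p + q)) + 2 = 2 * real (p + l + 1)" unfolding q by simp
    moreover have "radial_moment 0 l p q = fact (p + l) / (real (p + l + 1) * fact (p + l))"
      unfolding radial_moment_def q by simp
    ultimately show ?thesis by (simp only:) (simp del: of_nat_add of_nat_Suc)
  qed
  with cos_power_sin_2_has_integral[of "l + (p + q)"] show ?case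
    by (simp add: power_add mult_ac)
next
  case (Suc k)
  note IHk = Suc.IH
  from Suc.prems show ?case
  proof (induction l arbitrary: p q)
    case 0
    have "2 / (real (Suc k + (p + q)) + 2) = radial_moment (Suc k) 0 p q"
    proof -
      have p: "p = q + Suc k" using 0 by simp
      have "real (Suc k + (p + q)) + 2 = 2 * real (p + 1)" unfolding p by simp
      moreover have "radial_moment (Suc k) 0 p q = fact p / (real (p + 1) * fact p)"
        unfolding radial_moment_def p by simp
      ultimately show ?thesis by (simp only:) (simp del: of_nat_add of_nat_Suc)
    qed
    with cos_power_sin_2_has_integral[of "Suc k + (p + q)"] show ?case
      by (simp add: power_add mult_ac)
  next
    case (Suc l)
    have "((\<lambda>r. disk k (Suc l) (cos r) (cos r) * cos r ^ (p + Suc q) * sin (2 * r)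
        + disk (Suc k) l (cos r) (cos r) * cos r ^ (Suc p + q) * sin (2 * r)
        - disk k l (cos r) (cos r) * cos r ^ (p + q) * sin (2 * r)) has_integral
        radial_moment k (Suc l) p (Suc q) + radial_moment (Suc k) l (Suc p) q - radial_moment k l p q) {0..pi/2}"
      using Suc.prems by (intro has_integral_diff has_integral_add IHk Suc.IH) auto
    also have "radial_moment k (Suc l) p (Suc q) + radial_moment (Suc k) l (Suc p) q - radial_moment k l p q = radial_moment (Suc k) (Suc l) p q"
      using Suc.prems by (intro radial_moment_rec) simp
    finally show ?case by (simp add: algebra_simps)
  qed
qed

lemma space_haar: "space haar_SU2 = SU2" and sets_haar: "sets haar_SU2 = sets (restrict_space borel SU2)"
  by (simp_all add: haar_SU2_def space_restrict_space)

lemma finite_measure_haar: "finite_measure haar_SU2"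
  by (rule finite_measureI) (simp add: emeasure_haar_SU2)

lemma measurable_haar:
  fixes F :: "cmat \<Rightarrow> 'b::topological_space"
  assumes "continuous_on SU2 F"
  shows "F \<in> borel_measurable haar_SU2"
  using borel_measurable_continuous_on_restrict[OF assms]
  by (simp add: measurable_cong_sets[OF sets_haar refl])

lemma integrable_haar:
  fixes F :: "cmat \<Rightarrow> 'b::{banach, second_countable_topology}"
  assumes "continuous_on SU2 F"
  shows "integrable haar_SU2 F"
proof -
  interpret finite_measure haar_SU2 by (rule finite_measure_haar)
  have "bounded (F ` SU2)"
    using compact_continuous_image[OF assms compact_SU2] by (rule compact_imp_bounded)
  then obtain B where "\<And>g. g \<in> SU2 \<Longrightarrow> norm (F g) \<le> B"
    by (auto simp: bounded_iff)
  then show ?thesis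
    by (intro integrable_const_bound[of _ B] measurable_haar assms) (auto simp: space_haar)
qed

text \<open>The density of the measure as a real function; outside the coordinate box the indicator
  makes it zero, so that it is nonnegative everywhere.\<close>
definition cyl_density :: "real \<times> real \<times> real \<Rightarrow> real" where
  "cyl_density = (\<lambda>(r, \<theta>, z). sin (2 * r) / (4 * pi\<^sup>2) * indicator ({0..<pi/2} \<times> {0..2*pi} \<times> {-pi..pi}) (r, \<theta>, z))"

lemma cyl_density_measurable[measurable]: "cyl_density \<in> borel_measurable borel"
  unfolding cyl_density_def by (simp add: borel_prod[symmetric])

lemma cyl_density_nonneg: "0 \<le> cyl_density x"
  by (auto simp: cyl_density_def indicator_def split: prod.split intro!: divide_nonneg_nonneg sin_ge_zero)

lemma haar_eq: "haar_SU2 = distr (density lborel (\<lambda>x. ennreal (cyl_density x))) (restrict_space borel SU2) (\<lambda>(r, \<theta>, z). cyl r \<theta> z)"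
proof -
  have "(\<lambda>(r, \<theta>, z). ennreal (sin (2 * r) / (4 * pi\<^sup>2)) * indicator ({0..<pi/2} \<times> {0..2*pi} \<times> {-pi..pi}) (r, \<theta>, z))
    = (\<lambda>x. ennreal (cyl_density x))"
    by (auto simp: cyl_density_def indicator_def)
  then show ?thesis unfolding haar_SU2_def by simp
qed

lemma cyl_measurable_density [measurable]:
  "(\<lambda>(r, \<theta>, z). cyl r \<theta> z) \<in> density lborel (\<lambda>x. ennreal (cyl_density x)) \<rightarrow>\<^sub>M restrict_space borel SU2"
  using cyl_measurable by (simp cong: measurable_cong_sets)

lemma lborel_integral_product:
  fixes f g :: "_::euclidean_space \<Rightarrow> complex"
  assumes f: "integrable lborel f" and g: "integrable lborel g"
  shows "integrable lborel (\<lambda>(x, y). f x * g y)"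
    and "(LINT x|lborel. (\<lambda>(x, y). f x * g y) x) = (LINT x|lborel. f x) * (LINT y|lborel. g y)"
proof -
  have [measurable]: "f \<in> borel_measurable borel" "g \<in> borel_measurable borel" using f g by auto
  have "integrable (lborel \<Otimes>\<^sub>M lborel) (\<lambda>(x, y). f x * g y)"
    by (rule lborel_pair.Fubini_integrable) (auto simp: norm_mult intro!: integrable_mult_left integrable_norm f g)
  then show i: "integrable lborel (\<lambda>(x, y). f x * g y)" by (simp add: lborel_prod)
  show "(LINT x|lborel. (\<lambda>(x, y). f x * g y) x) = (LINT x|lborel. f x) * (LINT y|lborel. g y)"
    using lborel_pair.integral_fst'[of "\<lambda>(x, y). f x * g y"] i by (simp add: lborel_prod)
qed

text \<open>Fubini in cylindric coordinates. The half-open range of \<open>r\<close> in the definition of the measure may be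
  closed since \<open>sin (2r)\<close> vanishes at \<open>\<pi>/2\<close>.\<close>
lemma haar_integral_product:
  fixes F :: "cmat \<Rightarrow> complex" and A B C :: "real \<Rightarrow> complex"
  assumes F: "continuous_on SU2 F" and cont: "continuous_on UNIV A" "continuous_on UNIV B" "continuous_on UNIV C"
    and eq: "\<And>r \<theta> z. F (cyl r \<theta> z) = A r * (B \<theta> * C z)"
    and A: "((\<lambda>r. A r * of_real (sin (2 * r))) has_integral a) {0..pi/2}"
    and B: "(B has_integral b) {0..2*pi}" and C: "(C has_integral c) {-pi..pi}"
  shows "(LINT g|haar_SU2. F g) = a * b * c / of_real (4 * pi\<^sup>2)"
proof -
  have lb: "integrable lborel (\<lambda>x. indicator {u..v} x *\<^sub>R f x)"
      "(LINT x|lborel. indicator {u..v} x *\<^sub>R f x) = y"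
    if "continuous_on UNIV f" "(f has_integral y) {u..v}" for f :: "real \<Rightarrow> complex" and u v y
  proof -
    have "set_integrable lborel {u..v} f"
      by (rule borel_integrable_atLeastAtMost') (rule continuous_on_subset[OF that(1) subset_UNIV])
    then show "integrable lborel (\<lambda>x. indicator {u..v} x *\<^sub>R f x)" by (simp add: set_integrable_def)
    show "(LINT x|lborel. indicator {u..v} x *\<^sub>R f x) = y"
      using set_borel_integral_eq_integral(2)[OF \<open>set_integrable lborel {u..v} f\<close>] that(2)
      by (simp add: set_lebesgue_integral_def integral_unique)
  qed
  define A' where "A' r = indicator {0..pi/2} r *\<^sub>R (A r * of_real (sin (2 * r)))" for r :: real
  define B' where "B' \<theta> = indicator {0..2*pi} \<theta> *\<^sub>R B \<theta>" for \<theta> :: real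
  define C' where "C' z = indicator {-pi..pi} z *\<^sub>R C z" for z :: real
  have cA: "continuous_on UNIV (\<lambda>r. A r * of_real (sin (2 * r)))" by (intro continuous_intros cont)
  note A' = lb[OF cA A, folded A'_def] and B' = lb[OF cont(2) B, folded B'_def] and C' = lb[OF cont(3) C, folded C'_def]
  have "(LINT g|haar_SU2. F g) = (LINT x|density lborel (\<lambda>x. ennreal (cyl_density x)). F ((\<lambda>(r, \<theta>, z). cyl r \<theta> z) x))"
    unfolding haar_eq using measurable_haar[OF F]
    by (subst integral_distr) (auto simp: measurable_cong_sets[OF sets_haar refl])
  also have "\<dots> = (LINT x|lborel. cyl_density x *\<^sub>R F ((\<lambda>(r, \<theta>, z). cyl r \<theta> z) x))"
  proof (rule integral_density)
    have "(\<lambda>x. F ((\<lambda>(r, \<theta>, z). cyl r \<theta> z) x)) \<in> borel_measurable borel"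
      using measurable_haar[OF F] by (intro measurable_compose[OF cyl_measurable]) (simp add: measurable_cong_sets[OF sets_haar refl])
    then show "(\<lambda>x. F ((\<lambda>(r, \<theta>, z). cyl r \<theta> z) x)) \<in> borel_measurable lborel" by simp
  qed (auto simp: cyl_density_nonneg)
  also have "\<dots> = (LINT x|lborel. (1 / of_real (4 * pi\<^sup>2)) * (\<lambda>(r, y). A' r * (\<lambda>(\<theta>, z). B' \<theta> * C' z) y) x)"
  proof (rule Bochner_Integration.integral_cong)
    fix x :: "real \<times> real \<times> real"
    obtain r \<theta> z where x: "x = (r, \<theta>, z)" by (cases x)
    show "cyl_density x *\<^sub>R F ((\<lambda>(r, \<theta>, z). cyl r \<theta> z) x) = (1 / of_real (4 * pi\<^sup>2)) * (\<lambda>(r, y). A' r * (\<lambda>(\<theta>, z). B' \<theta> * C' z) y) x"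
    proof (cases "r = pi/2")
      case True
      then have "2 * r = pi" by simp
      then have "sin (2 * r) = 0" by (simp only: sin_pi)
      then show ?thesis unfolding x by (simp add: cyl_density_def A'_def)
    next
      case False
      then show ?thesis unfolding x
        by (auto simp: cyl_density_def A'_def B'_def C'_def indicator_def eq scaleR_conv_of_real)
    qed
  qed simp
  also have "\<dots> = (1 / of_real (4 * pi\<^sup>2)) * (a * (b * c))"
    using lborel_integral_product[OF A'(1) lborel_integral_product(1)[OF B'(1) C'(1)]]
      lborel_integral_product[OF B'(1) C'(1)] A'(2) B'(2) C'(2) by simp
  finally show ?thesis by (simp add: mult_ac)
qed

text \<open>Integration over \<open>\<theta>\<close> forces \<open>k = l\<close>, integration over \<open>z\<close> then forces equal frequencies, and
  the integral over \<open>r\<close> is a radial moment.\<close>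
lemma haar_disk_monomial:
  assumes kl: "k \<noteq> l \<or> k = 0 \<and> l = 0"
  shows "(LINT g|haar_SU2. disk i j (cnj (g $ 1 $ 1)) (g $ 1 $ 1) *
      ((g $ 1 $ 1) ^ p * cnj (g $ 1 $ 1) ^ q * (g $ 1 $ 2) ^ k * cnj (g $ 1 $ 2) ^ l))
     = (if k = l \<and> p + j = q + i then of_real (radial_moment i j p q) else 0)"
proof -
  let ?F = "\<lambda>g. disk i j (cnj (g $ 1 $ 1)) (g $ 1 $ 1) *
      ((g $ 1 $ 1) ^ p * cnj (g $ 1 $ 1) ^ q * (g $ 1 $ 2) ^ k * cnj (g $ 1 $ 2) ^ l)"
  define A where "A r = complex_of_real (disk i j (cos r) (cos r) * cos r ^ (p + q) * sin r ^ (k + l))" for r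
  define B where "B \<theta> = cis (of_int (int k - int l) * \<theta>)" for \<theta>
  define C where "C z = cis (of_int (int p - int q - (int i - int j) - (int k - int l)) * z)" for z
  have eq: "?F (cyl r \<theta> z) = A r * (B \<theta> * C z)" for r \<theta> z
  proof -
    have \<alpha>: "cyl r \<theta> z $ 1 $ 1 = of_real (cos r) * cis z" and \<beta>: "cyl r \<theta> z $ 1 $ 2 = of_real (sin r) * cis (\<theta> - z)"
      by (simp_all add: cyl_eq)
    have "?F (cyl r \<theta> z) = A r * (cis (- ((real i - real j) * z)) * (cis z ^ p * cis (- z) ^ q * cis (\<theta> - z) ^ k * cis (- (\<theta> - z)) ^ l))"
      unfolding \<alpha> \<beta> disk_polar by (simp add: A_def power_mult_distrib power_add cis_cnj mult_ac)
    also have "cis (- ((real i - real j) * z)) * (cis z ^ p * cis (- z) ^ q * cis (\<theta> - z) ^ k * cis (- (\<theta> - z)) ^ l) = B \<theta> * C z"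
      unfolding B_def C_def Complex.DeMoivre cis_mult by (rule arg_cong[of _ _ cis]) (simp add: algebra_simps)
    finally show ?thesis .
  qed
  have contF: "continuous_on SU2 ?F" by (intro continuous_intros)
  have cA: "continuous_on UNIV A" unfolding A_def by (intro continuous_intros)
  have cB: "continuous_on UNIV B" unfolding B_def cis_conv_exp by (intro continuous_intros)
  have cC: "continuous_on UNIV C" unfolding C_def cis_conv_exp by (intro continuous_intros)
  have B: "(B has_integral (if int k - int l = 0 then 2 * pi else 0)) {0..2*pi}"
    unfolding B_def using integral_cis_period[of "int k - int l" 0] by simp
  have C: "(C has_integral (if int p - int q - (int i - int j) - (int k - int l) = 0 then 2 * pi else 0)) {-pi..pi}"
  proof -
    have "- pi + 2 * pi = pi" by simp
    then show ?thesis
      using integral_cis_period[of "int p - int q - (int i - int j) - (int k - int l)" "- pi"]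
      unfolding C_def by (simp only:)
  qed
  have "continuous_on UNIV (\<lambda>r. A r * of_real (sin (2 * r)))"
    by (intro continuous_intros cA)
  then have "(\<lambda>r. A r * of_real (sin (2 * r))) integrable_on {0..pi/2}"
    by (rule integrable_continuous_interval[OF continuous_on_subset]) simp
  then obtain a where a: "((\<lambda>r. A r * of_real (sin (2 * r))) has_integral a) {0..pi/2}"
    by (auto simp: integrable_on_def)
  note I = haar_integral_product[OF contF cA cB cC eq a B C]
  show ?thesis
  proof (cases "k = l \<and> p + j = q + i")
    case True
    with kl have k: "k = 0" "l = 0" by auto
    have "((\<lambda>r. A r * of_real (sin (2 * r))) has_integral of_real (radial_moment i j p q)) {0..pi/2}"
      using has_integral_of_real[OF disk_moment[of p j q i]] True by (simp add: A_def k)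
    with a have "a = of_real (radial_moment i j p q)" by (rule has_integral_unique)
    moreover have "int p - int q - (int i - int j) - (int k - int l) = 0" "int k - int l = 0" using True by auto
    ultimately show ?thesis using I True by (simp add: power2_eq_square)
  next
    case False
    then have "int k - int l \<noteq> 0 \<or> int p - int q - (int i - int j) - (int k - int l) \<noteq> 0" by auto
    then show ?thesis using I False by auto
  qed
qed

text \<open>Only finitely many disk polynomials have a nonzero moment against \<open>\<alpha>\<^sup>p \<alpha>*\<^sup>q\<close>: those with indices
  \<open>i = p - e\<close> and \<open>j = q - e\<close>, of degree \<open>m = p + q - 2e\<close>.\<close>
lemma sums_monomial_heat:
  "(\<lambda>m. (real m + 1) * (\<Sum>i\<le>m. exp (- decay_rate i (m - i) * t) * (if p + (m - i) = q + i then radial_moment i (m - i) p q else 0)))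
     sums monomial_heat p q t"
proof -
  define G where "G m i = (real m + 1) * (exp (- decay_rate i (m - i) * t) * (if p + (m - i) = q + i then radial_moment i (m - i) p q else 0))" for m i
  have nz: "i \<le> p \<and> p + (m - i) = q + i \<and> m = p + q - 2 * (p - i) \<and> p - i \<le> q" if "G m i \<noteq> 0" "i \<le> m" for m i
  proof -
    have "p + (m - i) = q + i" "i \<le> p" using that by (auto simp: G_def radial_moment_def split: if_splits)
    then show ?thesis using that(2) by auto
  qed
  have fin: "m \<le> p + q" if "(\<Sum>i\<le>m. G m i) \<noteq> 0" for m
  proof -
    obtain i where "i \<in> {..m}" "G m i \<noteq> 0" using \<open>_ \<noteq> 0\<close> by (rule sum.not_neutral_contains_not_neutral)
    with nz show ?thesis by fastforce
  qed
  have "(\<lambda>m. \<Sum>i\<le>m. G m i) sums (\<Sum>m\<le>p + q. \<Sum>i\<le>m. G m i)"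
    by (rule sums_finite) (use fin in auto)
  also have "(\<Sum>m\<le>p + q. \<Sum>i\<le>m. G m i) = (\<Sum>(m, i)\<in>(SIGMA m:{..p + q}. {..m}). G m i)"
    by (simp add: sum.Sigma)
  also have "\<dots> = (\<Sum>e\<le>min p q. G (p + q - 2 * e) (p - e))"
  proof -
    let ?h = "\<lambda>e. (p + q - 2 * e, p - e)"
    have "(\<Sum>(m, i)\<in>(SIGMA m:{..p + q}. {..m}). G m i) = (\<Sum>(m, i)\<in>?h ` {..min p q}. G m i)"
    proof (rule sum.mono_neutral_right)
      show "\<forall>x\<in>(SIGMA m:{..p + q}. {..m}) - ?h ` {..min p q}. (case x of (m, i) \<Rightarrow> G m i) = 0"
      proof (clarsimp, rule ccontr)
        fix m i assume m: "m \<le> p + q" "i \<le> m" "(m, i) \<notin> ?h ` {..min p q}" "G m i \<noteq> 0"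
        from nz[OF m(4,2)] have "(m, i) = ?h (p - i)" "p - i \<in> {..min p q}" by auto
        with m(3) show False by blast
      qed
    qed auto
    also have "\<dots> = (\<Sum>e\<le>min p q. G (p + q - 2 * e) (p - e))"
      by (subst sum.reindex) (auto simp: inj_on_def)
    finally show ?thesis .
  qed
  also have "\<dots> = monomial_heat p q t"
    unfolding monomial_heat_def
  proof (rule sum.cong)
    fix e assume "e \<in> {..min p q}"
    then have e: "e \<le> p" "e \<le> q" by auto
    then have 1: "p + q - 2 * e - (p - e) = q - e" "p + (q - e) = q + (p - e)" "p - (p - e) = e" "p + (q - e) + 1 = p + q + 1 - e"
      by auto
    have 2: "real (p + q - 2 * e) + 1 = real (p + q + 1) - 2 * real e" using e by (simp add: of_nat_diff)
    have 3: "radial_moment (p - e) (q - e) p q = fact p * fact q / (fact e * fact (p + q + 1 - e))"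
      unfolding radial_moment_def 1(3,4) by simp
    show "G (p + q - 2 * e) (p - e) = (real (p + q + 1) - 2 * real e) * (fact p * fact q / (fact e * fact (p + q + 1 - e)))
       * exp (- decay_rate (p - e) (q - e) * t)"
      unfolding G_def 1(1) 2 3 by (simp only: 1(2) refl if_True mult_ac)
  qed simp
  finally show ?thesis unfolding G_def sum_distrib_left .
qed

lemma continuous_on_heat_mode: "continuous_on S (heat_mode t m)"
  unfolding heat_mode_def by (intro continuous_intros)

lemma continuous_on_heat_series:
  assumes "t > 0"
  shows "continuous_on SU2 (\<lambda>g. heat_series t (g $ 1 $ 1))"
proof -
  have "uniform_limit (cball 0 1) (\<lambda>n \<alpha>. \<Sum>m<n. heat_mode t m \<alpha>) (heat_series t) sequentially"
    unfolding heat_series_def[abs_def]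
    by (rule Weierstrass_m_test[OF norm_heat_mode_le summable_cube_exp]) (use assms in auto)
  then have "continuous_on (cball 0 1) (heat_series t)"
    by (rule uniform_limit_theorem[rotated]) (auto intro!: always_eventually continuous_intros continuous_on_heat_mode)
  then show ?thesis
    by (rule continuous_on_compose2) (auto intro!: continuous_intros SU2_norm_entry_le)
qed

text \<open>Monomials are bounded by \<open>1\<close> on \<open>SU(2)\<close>, so the uniform bound on the modes allows integrating the
  series term by term.\<close>
lemma haar_heat_series_monomial:
  assumes t: "t > 0" and kl: "k \<noteq> l \<or> k = 0 \<and> l = 0"
  shows "(LINT g|haar_SU2. heat_series t (g $ 1 $ 1) *
      ((g $ 1 $ 1) ^ p * cnj (g $ 1 $ 1) ^ q * (g $ 1 $ 2) ^ k * cnj (g $ 1 $ 2) ^ l))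
     = (if k = l then of_real (monomial_heat p q t) else 0)"
proof -
  interpret finite_measure haar_SU2 by (rule finite_measure_haar)
  let ?M = "\<lambda>g::cmat. (g $ 1 $ 1) ^ p * cnj (g $ 1 $ 1) ^ q * (g $ 1 $ 2) ^ k * cnj (g $ 1 $ 2) ^ l"
  let ?f = "\<lambda>m g. heat_mode t m (g $ 1 $ 1) * ?M g"
  have contf: "continuous_on SU2 (?f m)" for m
    by (intro continuous_intros continuous_on_compose2[OF continuous_on_heat_mode[of UNIV]]) auto
  have M1: "norm (?M g) \<le> 1" if "g \<in> SU2" for g
    using SU2_norm_entry_le[OF that] by (simp add: norm_mult norm_power mult_le_one power_le_one)
  have bound: "norm (?f m g) \<le> (real m + 1) ^ 3 * exp (- 2 * t * real m)" if "g \<in> SU2" for m g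
    using mult_mono[OF norm_heat_mode_le[OF SU2_norm_entry_le(1)[OF that] t, of m] M1[OF that]]
    by (simp add: norm_mult)
  have "(\<lambda>m. LINT g|haar_SU2. ?f m g) sums (LINT g|haar_SU2. (\<Sum>m. ?f m g))"
  proof (rule sums_integral)
    show "integrable haar_SU2 (?f m)" for m by (rule integrable_haar[OF contf])
    show "AE g in haar_SU2. summable (\<lambda>m. norm (?f m g))"
    proof (rule AE_I2)
      fix g assume "g \<in> space haar_SU2"
      then show "summable (\<lambda>m. norm (?f m g))"
        using bound by (intro summable_comparison_test'[OF summable_cube_exp[OF t]]) (auto simp: space_haar)
    qed
    show "summable (\<lambda>m. LINT g|haar_SU2. norm (?f m g))"
    proof (rule summable_comparison_test'[OF summable_cube_exp[OF t]])
      fix m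
      have "(LINT g|haar_SU2. norm (?f m g)) \<le> (LINT g|haar_SU2. (real m + 1) ^ 3 * exp (- 2 * t * real m))"
        using bound by (intro integral_mono integrable_norm integrable_haar contf) (auto simp: space_haar)
      also have "\<dots> = (real m + 1) ^ 3 * exp (- 2 * t * real m)"
        using emeasure_haar_SU2 by (simp add: measure_def)
      finally show "norm (LINT g|haar_SU2. norm (?f m g)) \<le> (real m + 1) ^ 3 * exp (- 2 * t * real m)"
        by simp
    qed
  qed
  also have "(LINT g|haar_SU2. (\<Sum>m. ?f m g)) = (LINT g|haar_SU2. heat_series t (g $ 1 $ 1) * ?M g)"
  proof (rule Bochner_Integration.integral_cong)
    fix g assume "g \<in> space haar_SU2"
    then show "(\<Sum>m. ?f m g) = heat_series t (g $ 1 $ 1) * ?M g"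
      unfolding heat_series_def
      by (intro suminf_mult2[symmetric] heat_series_summable t SU2_norm_entry_le) (simp add: space_haar)
  qed simp
  finally have S: "(\<lambda>m. LINT g|haar_SU2. ?f m g) sums (LINT g|haar_SU2. heat_series t (g $ 1 $ 1) * ?M g)" .
  have f: "(LINT g|haar_SU2. ?f m g) = (if k = l then of_real ((real m + 1) *
      (\<Sum>i\<le>m. exp (- decay_rate i (m - i) * t) * (if p + (m - i) = q + i then radial_moment i (m - i) p q else 0))) else 0)" for m
  proof -
    have "(LINT g|haar_SU2. ?f m g) = (LINT g|haar_SU2. of_nat (m + 1) * (\<Sum>i\<le>m. of_real (exp (- decay_rate i (m - i) * t)) *
        (disk i (m - i) (cnj (g $ 1 $ 1)) (g $ 1 $ 1) * ?M g)))"
      unfolding heat_mode_def by (simp add: sum_distrib_right mult.assoc)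
    also have "\<dots> = of_nat (m + 1) * (\<Sum>i\<le>m. of_real (exp (- decay_rate i (m - i) * t)) *
        (LINT g|haar_SU2. disk i (m - i) (cnj (g $ 1 $ 1)) (g $ 1 $ 1) * ?M g))"
      by (subst integral_mult_right_zero, subst Bochner_Integration.integral_sum)
         (auto intro!: integrable_haar continuous_intros)
    also have "\<dots> = (if k = l then of_real ((real m + 1) *
      (\<Sum>i\<le>m. exp (- decay_rate i (m - i) * t) * (if p + (m - i) = q + i then radial_moment i (m - i) p q else 0))) else 0)"
      unfolding haar_disk_monomial[OF kl]
      by (cases "k = l") (simp_all add: add.commute[of 1] if_distrib[of complex_of_real] cong: if_cong)
    finally show ?thesis .
  qed
  show ?thesis
  proof (cases "k = l")
    case True
    from S[unfolded f] sums_of_real[OF sums_monomial_heat[of t p q]] show ?thesis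
      using True by (auto intro: sums_unique2)
  next
    case False
    from S[unfolded f] show ?thesis using False sums_unique2[OF _ sums_zero] by auto
  qed
qed

section \<open>Identification of the heat kernel\<close>

text \<open>The measure has a positive density on the open coordinate box, and a continuous function
  vanishing almost everywhere on an open set vanishes on its closure.\<close>
lemma haar_null_imp_zero:
  assumes E: "continuous_on SU2 E" and ae: "AE g in haar_SU2. E g = (0::real)"
    and r: "0 \<le> r" "r \<le> pi/2" and \<theta>: "0 \<le> \<theta>" "\<theta> \<le> 2 * pi" and z: "- pi \<le> z" "z \<le> pi"
  shows "E (cyl r \<theta> z) = 0"
proof -
  let ?c = "\<lambda>(r, \<theta>, z). cyl r \<theta> z" and ?S = "{0<..<pi/2} \<times> {0<..<2*pi} \<times> {-pi<..<pi}"
  have contc: "continuous_on UNIV ?c"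
  proof -
    have "continuous_on UNIV (\<lambda>x::real\<times>real\<times>real. cyl (fst x) (fst (snd x)) (snd (snd x)) $ i $ j)" for i j
      using exhaust_2[of i] exhaust_2[of j]
      by (elim disjE; simp add: cyl_eq cis_conv_exp; intro continuous_intros)
    then have "continuous_on UNIV (\<lambda>x::real\<times>real\<times>real.
        \<chi> i. \<chi> j. cyl (fst x) (fst (snd x)) (snd (snd x)) $ i $ j)"
      by (intro continuous_on_vec_lambda) auto
    then show ?thesis by (simp add: case_prod_beta')
  qed
  define C where "C = {x. E (?c x) = 0}"
  have cE: "continuous_on UNIV (\<lambda>x. E (?c x))"
    by (rule continuous_on_compose2[OF E contc]) (auto simp: cyl_in_SU2)
  have closed: "closed C"
    unfolding C_def using cE by (intro closed_Collect_eq) auto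
  have [measurable]: "E \<in> borel_measurable (restrict_space borel SU2)"
    by (rule borel_measurable_continuous_on_restrict[OF E])
  have "AE x in density lborel (\<lambda>x. ennreal (cyl_density x)). E (?c x) = 0"
    using ae unfolding haar_eq by (subst (asm) AE_distr_iff) (auto simp: pred_def)
  then have "AE x in lborel. 0 < cyl_density x \<longrightarrow> x \<in> C"
    by (subst (asm) AE_density) (auto simp: C_def)
  moreover have pos: "0 < cyl_density x" if "x \<in> ?S" for x
    using that by (auto simp: cyl_density_def intro!: divide_pos_pos sin_gt_zero)
  ultimately have "AE x in lborel. x \<in> ?S \<longrightarrow> x \<in> C"
    by (auto elim!: eventually_mono)
  then have "AE x\<in>?S in lebesgue. x \<in> C"
    by (rule AE_completion)
  then have "?S \<subseteq> C"
    by (intro subsetI mem_closed_if_AE_lebesgue_open[OF _ closed]) (auto intro!: open_Times)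
  then have "closure ?S \<subseteq> C"
    by (rule closure_minimal[OF _ closed])
  moreover have "(r, \<theta>, z) \<in> closure ?S"
    using r \<theta> z by (simp add: closure_Times)
  ultimately show ?thesis by (auto simp: C_def)
qed

text \<open>If \<open>f\<close> is a polynomial within \<open>e\<close> of \<open>E\<close>, then \<open>\<integral> E\<^sup>2 = \<integral> E (E - f) \<le> e \<integral> \<bar>E\<bar>\<close>.\<close>
lemma orthogonal_to_polynomials_imp_zero:
  assumes E: "continuous_on SU2 E"
    and orth: "\<And>f. real_polynomial_function f \<Longrightarrow> (LINT g|haar_SU2. E g * f g) = 0"
  shows "AE g in haar_SU2. E g = (0::real)"
proof -
  have i: "integrable haar_SU2 (\<lambda>g. E g * f g)" if "continuous_on SU2 f" for f
    by (intro integrable_haar continuous_intros E that)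
  define I where "I = (LINT g|haar_SU2. \<bar>E g\<bar>)"
  have I0: "I \<ge> 0" unfolding I_def by simp
  have iE: "integrable haar_SU2 (\<lambda>g. \<bar>E g\<bar>)"
    by (intro integrable_haar continuous_intros E)
  have small: "(LINT g|haar_SU2. E g * E g) \<le> e * I" if e: "e > 0" for e
  proof -
    obtain f where f: "real_polynomial_function f" "\<And>g. g \<in> SU2 \<Longrightarrow> \<bar>E g - f g\<bar> < e"
      using Stone_Weierstrass_real_polynomial_function[OF compact_SU2 E e] by blast
    have cf: "continuous_on SU2 f" by (rule continuous_on_real_polynomial[OF f(1)])
    have "(LINT g|haar_SU2. E g * E g) = (LINT g|haar_SU2. E g * E g) - (LINT g|haar_SU2. E g * f g)"
      using orth[OF f(1)] by simp
    also have "\<dots> = (LINT g|haar_SU2. E g * E g - E g * f g)"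
      by (rule Bochner_Integration.integral_diff[symmetric]) (intro i E cf)+
    also have "\<dots> \<le> (LINT g|haar_SU2. e * \<bar>E g\<bar>)"
    proof (rule integral_mono)
      show "integrable haar_SU2 (\<lambda>g. E g * E g - E g * f g)" by (intro Bochner_Integration.integrable_diff i E cf)
      show "integrable haar_SU2 (\<lambda>g. e * \<bar>E g\<bar>)" using iE by simp
      fix g assume "g \<in> space haar_SU2"
      then have "\<bar>E g - f g\<bar> \<le> e" using f(2) by (force simp: space_haar)
      then have "\<bar>E g\<bar> * \<bar>E g - f g\<bar> \<le> \<bar>E g\<bar> * e" by (intro mult_left_mono) auto
      moreover have "E g * E g - E g * f g \<le> \<bar>E g\<bar> * \<bar>E g - f g\<bar>"
        by (simp add: abs_mult[symmetric] right_diff_distrib[symmetric])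
      ultimately show "E g * E g - E g * f g \<le> e * \<bar>E g\<bar>" by (simp add: mult.commute)
    qed
    also have "\<dots> = e * I" unfolding I_def by simp
    finally show ?thesis .
  qed
  have "(LINT g|haar_SU2. E g * E g) \<le> 0"
  proof (rule field_le_epsilon)
    fix e :: real assume "e > 0"
    then have "(LINT g|haar_SU2. E g * E g) \<le> e / (I + 1) * I" using I0 by (intro small) simp
    also have "\<dots> \<le> e" using \<open>e > 0\<close> I0 by (simp add: field_simps)
    finally show "(LINT g|haar_SU2. E g * E g) \<le> 0 + e" by simp
  qed
  then have "(LINT g|haar_SU2. E g * E g) = 0"
    by (intro antisym integral_nonneg_AE) auto
  then have "AE g in haar_SU2. E g * E g = 0"
    using integral_nonneg_eq_0_iff_AE[OF i[OF E]] by simp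
  then show ?thesis by simp
qed

lemma continuous_on_heat_kernel:
  assumes "heat_kernel_at_identity P p" "t > 0"
  shows "continuous_on SU2 (p t)"
proof -
  have "smooth_SU2 (p t)" using assms unfolding heat_kernel_at_identity_def by blast
  then have "continuous_on SU2 (foldr left_field [] (p t))" unfolding smooth_SU2_def by (metis empty_set empty_subsetI)
  then show ?thesis by simp
qed

text \<open>Both sides are linear in \<open>f\<close> and depend only on the values of \<open>f\<close> on \<open>SU(2)\<close>, so it is
  enough to compare them on monomials in which \<open>\<beta>\<close> or \<open>\<beta>*\<close> does not occur. There the left-hand side
  is \<open>semigroup_re_monomial\<close> (after conjugation, if \<open>\<beta>*\<close> occurs) and the right-hand side is
  \<open>haar_heat_series_monomial\<close>.\<close>
lemma heat_kernel_integral_polynomial: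
  assumes P: "subelliptic_heat_semigroup P" and p: "heat_kernel_at_identity P p" and t: "t > 0"
    and f: "real_polynomial_function f"
  shows "of_real (LINT g|haar_SU2. p t g * f g) = (LINT g|haar_SU2. heat_series t (g $ 1 $ 1) * of_real (f g))"
proof -
  have contp: "continuous_on SU2 (p t)"
    by (rule continuous_on_heat_kernel[OF p t])
  have ker: "(LINT g|haar_SU2. p t g * f g) = P t f (mat 1)" if "continuous_on SU2 f" for f
    using p t that unfolding heat_kernel_at_identity_def by metis
  have cH: "continuous_on SU2 (\<lambda>g. heat_series t (g $ 1 $ 1))" by (rule continuous_on_heat_series[OF t])
  have cm: "continuous_on SU2 (re_monomial c a b k l)" for c a b k l
    by (intro continuous_on_real_polynomial real_polynomial_re_monomial)
  define good where "good f \<longleftrightarrow> continuous_on SU2 f \<and>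
     of_real (LINT g|haar_SU2. p t g * f g) = (LINT g|haar_SU2. heat_series t (g $ 1 $ 1) * of_real (f g))"
    for f :: "cmat \<Rightarrow> real"
  have good_cong: "good h" if "good f" "\<And>g. g \<in> SU2 \<Longrightarrow> h g = f g" for f h
  proof -
    have "continuous_on SU2 h" by (rule continuous_on_eq[of SU2 f]) (use that in \<open>auto simp: good_def\<close>)
    moreover have "(LINT g|haar_SU2. p t g * f g) = (LINT g|haar_SU2. p t g * h g)"
      "(LINT g|haar_SU2. heat_series t (g $ 1 $ 1) * of_real (f g)) = (LINT g|haar_SU2. heat_series t (g $ 1 $ 1) * of_real (h g))"
      using that(2) by (auto intro!: Bochner_Integration.integral_cong simp: space_haar)
    ultimately show ?thesis using that(1) unfolding good_def by simp
  qed
  have good_add: "good (\<lambda>g. a * f g + b * h g)" if "good f" "good h" for f h a b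
  proof -
    have c: "continuous_on SU2 f" "continuous_on SU2 h" using that unfolding good_def by auto
    have 1: "(LINT g|haar_SU2. p t g * (a * f g + b * h g)) = a * (LINT g|haar_SU2. p t g * f g) + b * (LINT g|haar_SU2. p t g * h g)"
    proof -
      have "(LINT g|haar_SU2. p t g * (a * f g + b * h g)) = (LINT g|haar_SU2. a * (p t g * f g) + b * (p t g * h g))"
        by (simp add: algebra_simps)
      also have "\<dots> = (LINT g|haar_SU2. a * (p t g * f g)) + (LINT g|haar_SU2. b * (p t g * h g))"
        by (intro Bochner_Integration.integral_add integrable_haar continuous_intros contp c)
      finally show ?thesis by simp
    qed
    have 2: "(LINT g|haar_SU2. heat_series t (g $ 1 $ 1) * of_real (a * f g + b * h g))
       = of_real a * (LINT g|haar_SU2. heat_series t (g $ 1 $ 1) * of_real (f g)) + of_real b * (LINT g|haar_SU2. heat_series t (g $ 1 $ 1) * of_real (h g))"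
    proof -
      have "(LINT g|haar_SU2. heat_series t (g $ 1 $ 1) * of_real (a * f g + b * h g))
        = (LINT g|haar_SU2. of_real a * (heat_series t (g $ 1 $ 1) * of_real (f g)) + of_real b * (heat_series t (g $ 1 $ 1) * of_real (h g)))"
        by (simp add: algebra_simps)
      also have "\<dots> = (LINT g|haar_SU2. of_real a * (heat_series t (g $ 1 $ 1) * of_real (f g))) + (LINT g|haar_SU2. of_real b * (heat_series t (g $ 1 $ 1) * of_real (h g)))"
        by (intro Bochner_Integration.integral_add integrable_haar continuous_intros cH c)
      finally show ?thesis by simp
    qed
    show ?thesis using that c unfolding good_def 1 2 by (auto intro!: continuous_intros)
  qed
  have base: "good (re_monomial c a b k l)" if kl: "k = 0 \<or> l = 0" for c a b k l
  proof -
    let ?M = "\<lambda>a b k l (g::cmat). (g $ 1 $ 1) ^ a * cnj (g $ 1 $ 1) ^ b * (g $ 1 $ 2) ^ k * cnj (g $ 1 $ 2) ^ l"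
    have "P t (re_monomial c a b k l) (mat 1) = (if k = l then Re c * monomial_heat a b t else 0)"
    proof (cases "l = 0")
      case True
      then show ?thesis using semigroup_re_monomial[OF P t, of c a b k] by simp
    next
      case False
      then have "k = 0" using kl by simp
      have "re_monomial c a b k l = re_monomial (cnj c) b a l 0"
        unfolding \<open>k = 0\<close> by (rule ext re_monomial_cnj)+
      then show ?thesis using semigroup_re_monomial[OF P t, of "cnj c" b a l] False \<open>k = 0\<close> by simp
    qed
    moreover have "(LINT g|haar_SU2. heat_series t (g $ 1 $ 1) * of_real (re_monomial c a b k l g))
       = of_real (if k = l then Re c * monomial_heat a b t else 0)"
    proof -
      have contM: "continuous_on SU2 (?M a b k l)" for a b k l by (intro continuous_intros)
      have kl': "k \<noteq> l \<or> k = 0 \<and> l = 0" "l \<noteq> k \<or> l = 0 \<and> k = 0" using kl by auto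
      have "of_real (re_monomial c a b k l g) = c / 2 * ?M a b k l g + cnj c / 2 * ?M b a l k g" for g
      proof -
        have R: "of_real (Re z) = z / 2 + cnj z / 2" for z by (simp add: complex_eq_iff)
        show ?thesis unfolding re_monomial_def R by (simp add: mult_ac)
      qed
      then have "(LINT g|haar_SU2. heat_series t (g $ 1 $ 1) * of_real (re_monomial c a b k l g))
        = (LINT g|haar_SU2. c / 2 * (heat_series t (g $ 1 $ 1) * ?M a b k l g) + cnj c / 2 * (heat_series t (g $ 1 $ 1) * ?M b a l k g))"
        by (simp only: distrib_left mult.left_commute)
      also have "\<dots> = (LINT g|haar_SU2. c / 2 * (heat_series t (g $ 1 $ 1) * ?M a b k l g)) + (LINT g|haar_SU2. cnj c / 2 * (heat_series t (g $ 1 $ 1) * ?M b a l k g))"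
        by (intro Bochner_Integration.integral_add integrable_haar continuous_intros cH)
      also have "\<dots> = c / 2 * (if k = l then of_real (monomial_heat a b t) else 0) + cnj c / 2 * (if l = k then of_real (monomial_heat b a t) else 0)"
        unfolding integral_mult_right_zero haar_heat_series_monomial[OF t kl'(1)] haar_heat_series_monomial[OF t kl'(2)] ..
      also have "\<dots> = of_real (if k = l then Re c * monomial_heat a b t else 0)"
        unfolding monomial_heat_commute[of b a] by (simp add: complex_eq_iff)
      finally show ?thesis .
    qed
    ultimately show ?thesis
      unfolding good_def ker[OF cm] using cm by simp
  qed
  have all: "good (re_monomial c a b k l)" for c a b k l
  proof (induction k arbitrary: a b l)
    case 0
    then show ?case by (simp add: base)
  next
    case (Suc k)
    show ?case
    proof (cases l)
      case 0
      then show ?thesis by (simp add: base)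
    next
      case (Suc l')
      have "good (\<lambda>g. 1 * re_monomial c a b k l' g + (-1) * re_monomial c (Suc a) (Suc b) k l' g)"
        by (intro good_add Suc.IH)
      then show ?thesis
        unfolding Suc by (rule good_cong) (simp add: re_monomial_reduce)
    qed
  qed
  have "good f"
    using re_monomial_span_real_polynomial[OF f]
  proof (induction rule: re_monomial_span.induct)
    case (mono f c p q k l)
    show ?case by (rule good_cong[OF all mono])
  next
    case (add f h e)
    show ?case by (rule good_cong[OF good_add[OF add.IH, of 1 1]]) (simp add: add.hyps)
  qed
  then show ?thesis unfolding good_def by blast
qed

text \<open>The series is complex-valued; that it is real comes out of the same
  orthogonality argument, applied to its imaginary part.\<close>
lemma heat_kernel_eq_heat_series:
  assumes P: "subelliptic_heat_semigroup P" and p: "heat_kernel_at_identity P p" and t: "t > 0"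
    and r: "0 \<le> r" "r \<le> pi/2" and \<theta>: "0 \<le> \<theta>" "\<theta> \<le> 2 * pi" and z: "- pi \<le> z" "z \<le> pi"
  shows "complex_of_real (p t (cyl r \<theta> z)) = heat_series t (of_real (cos r) * cis z)"
proof -
  let ?H = "\<lambda>g::cmat. heat_series t (g $ 1 $ 1)"
  have contp: "continuous_on SU2 (p t)"
    by (rule continuous_on_heat_kernel[OF p t])
  have contH: "continuous_on SU2 ?H" by (rule continuous_on_heat_series[OF t])
  have int: "of_real (LINT g|haar_SU2. p t g * f g) = (LINT g|haar_SU2. ?H g * of_real (f g))"
    if "real_polynomial_function f" for f
    by (rule heat_kernel_integral_polynomial[OF P p t that])
  have iH: "integrable haar_SU2 (\<lambda>g. ?H g * of_real (f g))" if "real_polynomial_function f" for f :: "cmat \<Rightarrow> real"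
    by (intro integrable_haar continuous_intros contH continuous_on_real_polynomial that)
  have "p t (cyl r \<theta> z) - Re (?H (cyl r \<theta> z)) = 0"
  proof (rule haar_null_imp_zero[OF _ orthogonal_to_polynomials_imp_zero r \<theta> z])
    show cE: "continuous_on SU2 (\<lambda>g. p t g - Re (?H g))" by (intro continuous_intros contp contH)
    then show "continuous_on SU2 (\<lambda>g. p t g - Re (?H g))" .
    fix f :: "cmat \<Rightarrow> real" assume f: "real_polynomial_function f"
    have c: "continuous_on SU2 f" by (rule continuous_on_real_polynomial[OF f])
    have "(LINT g|haar_SU2. (p t g - Re (?H g)) * f g) = (LINT g|haar_SU2. p t g * f g - Re (?H g * of_real (f g)))"
      by (simp add: algebra_simps)
    also have "\<dots> = (LINT g|haar_SU2. p t g * f g) - (LINT g|haar_SU2. Re (?H g * of_real (f g)))"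
      by (intro Bochner_Integration.integral_diff integrable_haar continuous_intros contp contH c)
    also have "(LINT g|haar_SU2. Re (?H g * of_real (f g))) = Re (LINT g|haar_SU2. ?H g * of_real (f g))"
      by (rule integral_Re[OF iH[OF f]])
    finally show "(LINT g|haar_SU2. (p t g - Re (?H g)) * f g) = 0"
      unfolding int[OF f, symmetric] by simp
  qed
  moreover have "Im (?H (cyl r \<theta> z)) = 0"
  proof (rule haar_null_imp_zero[OF _ orthogonal_to_polynomials_imp_zero r \<theta> z])
    show cE: "continuous_on SU2 (\<lambda>g. Im (?H g))" by (intro continuous_intros contH)
    then show "continuous_on SU2 (\<lambda>g. Im (?H g))" .
    fix f :: "cmat \<Rightarrow> real" assume f: "real_polynomial_function f"
    have "(LINT g|haar_SU2. Im (?H g) * f g) = (LINT g|haar_SU2. Im (?H g * of_real (f g)))"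
      by simp
    also have "\<dots> = Im (LINT g|haar_SU2. ?H g * of_real (f g))"
      by (rule integral_Im[OF iH[OF f]])
    finally show "(LINT g|haar_SU2. Im (?H g) * f g) = 0"
      unfolding int[OF f, symmetric] by simp
  qed
  ultimately have "complex_of_real (p t (cyl r \<theta> z)) = ?H (cyl r \<theta> z)"
    by (simp add: complex_eq_iff)
  then show ?thesis by (simp add: cyl_eq)
qed

theorem proposition3p5:
  fixes P :: "real \<Rightarrow> (complex^2^2 \<Rightarrow> real) \<Rightarrow> complex^2^2 \<Rightarrow> real"
    and p :: "real \<Rightarrow> complex^2^2 \<Rightarrow> real"
    and t r \<theta> z :: real
  assumes "subelliptic_heat_semigroup P"
    and "heat_kernel_at_identity P p"
    and "t > 0" and "0 \<le> r" and "r < pi / 2"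
    and "0 \<le> \<theta>" and "\<theta> \<le> 2 * pi" and "- pi \<le> z" and "z \<le> pi"
  shows "integrable lborel (\<lambda>y::real.
           exp (- ((complex_of_real y + \<i> * complex_of_real z)\<^sup>2 / complex_of_real (4 * t)))
             * complex_of_real (heat_q t (cos r * cosh y))) \<and>
         complex_of_real (p t (cyl r \<theta> z)) =
           complex_of_real (1 / sqrt (4 * pi * t)) *
             (LINT y|lborel. exp (- ((complex_of_real y + \<i> * complex_of_real z)\<^sup>2 / complex_of_real (4 * t)))
                * complex_of_real (heat_q t (cos r * cosh y)))"
proof -
  have \<rho>: "0 \<le> cos r" "cos r \<le> 1"
    using assms by (auto intro: cos_ge_zero)
  have "complex_of_real (p t (cyl r \<theta> z)) = heat_series t (of_real (cos r) * cis z)"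
    using assms by (intro heat_kernel_eq_heat_series) auto
  with gauss_transform_heat_q[OF \<open>t > 0\<close> \<rho>, of z] show ?thesis
    unfolding gauss_shift_def by simp
qed

end
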